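(* Let $(P_0,\dots,P_m)$ be a Clifford system on $\mathbb{R}^{2l}$ with $m=m_1\le m_2:=l-m-1$. Let $F(x)=\langle x,x\rangle^2-2\sum_{i=0}^m\langle P_ix,x\rangle^2$, $f=F|_{S^{2l-1}}$ and $M_-=f^{-1}(\{-1\})$. Let $P\in\Sigma:=\Sigma(P_0,\dots,P_m)$ and $y\in E_+(P)\cap S^{2l-1}$. Then $y\in M_-$ and $$E_+(P)=\mathbb{R}y\oplus \operatorname{Span}\bigcup_{N\in\perp_yM_-\setminus\{0\}}\ker S_N .$$ Since the Clifford sphere $\Sigma$ is uniquely determined by the set $\{E_+(P)\mid P\in\Sigma\}$, it is therefore uniquely determined by the isoparametric family of levels of $f$. In particular, the congruence class of the hypersurface family determines the geometric equivalence class of the Clifford system: if $(Q_0,\dots,Q_{m'})$ is another Clifford system on $\mathbb{R}^{2l}$ with $m'\le l-m'-1$ whose isoparametric family is congruent to that of $(P_0,\dots,P_m)$, then $m'=m$ and the two Clifford systems are geometrically equivalent.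
   Context: A (symmetric) Clifford system on $\mathbb{R}^{2l}$ ($l,m\geq 1$) is an $(m+1)$-tuple $(P_0,\dots,P_m)$ of symmetric endomorphisms of $\mathbb{R}^{2l}$ with $P_iP_j+P_jP_i=2\delta_{ij}\,\mathrm{Id}$ for all $i,j$. On symmetric endomorphisms use $\langle A,B\rangle:=\frac{1}{2l}\operatorname{Trace}(AB)$. The Clifford sphere $\Sigma(P_0,\dots,P_m)$ is the unit sphere of $\operatorname{Span}\{P_0,\dots,P_m\}$; every $P\in\Sigma$ satisfies $P^2=\mathrm{Id}$. $E_+(P)$ is the $+1$-eigenspace of $P$. Two Clifford systems $(P_0,\dots,P_m)$, $(Q_0,\dots,Q_m)$ on $\mathbb{R}^{2l}$ are geometrically equivalent if there exist $A\in O(\mathbb{R}^{2l})$ and an orthogonal transformation $B$ of $\operatorname{Span}\{P_0,\dots,P_m\}$ with $Q_i=A\,B(P_i)\,A^{t}$ for all $i$. When $m_2>0$, the level sets $f^{-1}(c)$, $-1<c<1$, form an isoparametric family (a parallel family of hypersurfaces with constant principal curvatures) with four distinct principal curvatures of multiplicities $m_1,m_2,m_1,m_2$, and $M_-$ is a focal submanifold of $S^{2l-1}$ of codimension $m_2+1$. $\perp_yM_-$ is the normal space of $M_-$ at $y$ inside $T_yS^{2l-1}$, and $S_N:T_yM_-\to T_yM_-$ is the second fundamental tensor (shape operator) of $M_-$ in $S^{2l-1}$ with respect to $N\in\perp_yM_-$. Subspaces of $T_yM_-$ are regarded as subspaces of $\mathbb{R}^{2l}$. Two isoparametric families in $S^{2l-1}$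 are congruent if some orthogonal transformation of $\mathbb{R}^{2l}$ carries the hypersurfaces of one onto those of the other. *)

theory Defs
  imports "HOL-Analysis.Analysis"
begin

section \<open>Clifford systems\<close>

text \<open>
  Endomorphisms of \<open>\<real>\<^sup>2\<^sup>l\<close> are matrices over an index type \<open>'n\<close> with \<open>CARD('n) = 2 * l\<close>.
  A system \<open>(P\<^sub>0, \<dots>, P\<^sub>m)\<close> is a sequence \<open>P\<close> of which only the entries \<open>P i\<close> with \<open>i \<le> m\<close> matter.
\<close>

definition clifford_system :: "nat \<Rightarrow> (nat \<Rightarrow> real^'n^'n) \<Rightarrow> bool" where
  "clifford_system m P \<longleftrightarrow>
     1 \<le> m \<and>
     (\<forall>i\<le>m. transpose (P i) = P i) \<and>
     (\<forall>i\<le>m. \<forall>j\<le>m. P i ** P j + P j ** P i = (if i = j then 2 *\<^sub>R mat 1 else 0))"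

text \<open>Here \<open>CARD('n)\<close> is the \<open>2l\<close> of the normalising factor.\<close>

definition endo_inner :: "real^'n^'n \<Rightarrow> real^'n^'n \<Rightarrow> real" where
  "endo_inner A B = trace (A ** B) / real CARD('n)"

definition clifford_span :: "nat \<Rightarrow> (nat \<Rightarrow> real^'n^'n) \<Rightarrow> (real^'n^'n) set" where
  "clifford_span m P = span (P ` {..m})"

definition clifford_sphere :: "nat \<Rightarrow> (nat \<Rightarrow> real^'n^'n) \<Rightarrow> (real^'n^'n) set" where
  "clifford_sphere m P = {A \<in> clifford_span m P. endo_inner A A = 1}"

definition E_plus :: "real^'n^'n \<Rightarrow> (real^'n) set" where
  "E_plus A = {x. A *v x = x}"

text \<open>
  Orthogonal transformations of a subspace \<open>V\<close> of endomorphisms; \<open>B\<close> is only constrained on \<open>V\<close>.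
\<close>

definition orthogonal_transformation_of ::
    "(real^'n^'n) set \<Rightarrow> (real^'n^'n \<Rightarrow> real^'n^'n) \<Rightarrow> bool" where
  "orthogonal_transformation_of V B \<longleftrightarrow>
     B ` V = V \<and>
     (\<forall>X\<in>V. \<forall>Y\<in>V. B (X + Y) = B X + B Y) \<and>
     (\<forall>c. \<forall>X\<in>V. B (c *\<^sub>R X) = c *\<^sub>R B X) \<and>
     (\<forall>X\<in>V. \<forall>Y\<in>V. endo_inner (B X) (B Y) = endo_inner X Y)"

definition geometrically_equivalent ::
    "nat \<Rightarrow> (nat \<Rightarrow> real^'n^'n) \<Rightarrow> (nat \<Rightarrow> real^'n^'n) \<Rightarrow> bool" where
  "geometrically_equivalent m P Q \<longleftrightarrow>
     (\<exists>A B. orthogonal_matrix A \<and> orthogonal_transformation_of (clifford_span m P) B \<and>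
            (\<forall>i\<le>m. Q i = A ** B (P i) ** transpose A))"

section \<open>The isoparametric family\<close>

definition clifford_F :: "nat \<Rightarrow> (nat \<Rightarrow> real^'n^'n) \<Rightarrow> real^'n \<Rightarrow> real" where
  "clifford_F m P x = (x \<bullet> x)\<^sup>2 - 2 * (\<Sum>i\<le>m. ((P i *v x) \<bullet> x)\<^sup>2)"

text \<open>The level set \<open>f\<^sup>-\<^sup>1(c)\<close> of the restriction \<open>f\<close> of \<open>F\<close> to the unit sphere.\<close>

definition level :: "nat \<Rightarrow> (nat \<Rightarrow> real^'n^'n) \<Rightarrow> real \<Rightarrow> (real^'n) set" where
  "level m P c = {x \<in> sphere 0 1. clifford_F m P x = c}"

definition M_minus :: "nat \<Rightarrow> (nat \<Rightarrow> real^'n^'n) \<Rightarrow> (real^'n) set" where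
  "M_minus m P = level m P (-1)"

text \<open>
  The family is the set of its hypersurfaces, without the parameter \<open>c\<close>; a congruence may
  therefore permute the levels.
\<close>

definition isoparametric_family :: "nat \<Rightarrow> (nat \<Rightarrow> real^'n^'n) \<Rightarrow> (real^'n) set set" where
  "isoparametric_family m P = level m P ` {-1<..<1}"

definition congruent_families :: "(real^'n) set set \<Rightarrow> (real^'n) set set \<Rightarrow> bool" where
  "congruent_families \<F> \<G> \<longleftrightarrow>
     (\<exists>A. orthogonal_matrix A \<and> (\<lambda>M. (\<lambda>x. A *v x) ` M) ` \<F> = \<G>)"

section \<open>Submanifolds of a Euclidean space\<close>

text \<open>\<open>k\<close>-fold differentiability on an open set, via iterated directional derivatives.\<close>

primrec times_differentiable_on ::
    "nat \<Rightarrow> ('a::euclidean_space \<Rightarrow> 'b::euclidean_space) \<Rightarrow> 'a set \<Rightarrow> bool" where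
  "times_differentiable_on 0 f U \<longleftrightarrow> continuous_on U f"
| "times_differentiable_on (Suc k) f U \<longleftrightarrow>
     (\<forall>x\<in>U. f differentiable (at x)) \<and>
     (\<forall>v. times_differentiable_on k (\<lambda>x. frechet_derivative f (at x) v) U)"

definition smooth_on_open :: "('a::euclidean_space \<Rightarrow> 'b::euclidean_space) \<Rightarrow> 'a set \<Rightarrow> bool" where
  "smooth_on_open f U \<longleftrightarrow> open U \<and> (\<forall>k. times_differentiable_on k f U)"

text \<open>Velocities at \<open>y\<close> of the smooth curves in \<open>M\<close> through \<open>y\<close>.\<close>

definition tangent_space :: "'a::euclidean_space set \<Rightarrow> 'a \<Rightarrow> 'a set" where
  "tangent_space M y =
     {v. \<exists>c::real \<Rightarrow> 'a. \<exists>e>0. smooth_on_open c {-e<..<e} \<and> (\<forall>t\<in>{-e<..<e}. c t \<in> M) \<and>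
           c 0 = y \<and> (c has_vector_derivative v) (at 0)}"

text \<open>The normal space of \<open>M\<close> at \<open>y\<close> inside the tangent space of the ambient manifold \<open>S\<close>.\<close>

definition normal_space_at :: "'a::euclidean_space set \<Rightarrow> 'a set \<Rightarrow> 'a \<Rightarrow> 'a set" where
  "normal_space_at S M y = {v \<in> tangent_space S y. \<forall>w\<in>tangent_space M y. orthogonal v w}"

definition orthogonal_projection :: "'a::euclidean_space set \<Rightarrow> 'a \<Rightarrow> 'a" where
  "orthogonal_projection V x = (THE p. p \<in> V \<and> (\<forall>v\<in>V. orthogonal (x - p) v))"

text \<open>
  The Levi-Civita derivative on the submanifold \<open>S\<close>, with the induced metric, of a vector field
  along a submanifold of \<open>S\<close>, given as an extension \<open>\<eta>\<close> to a neighbourhood in the Euclidean space.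
\<close>

definition covariant_derivative ::
    "'a::euclidean_space set \<Rightarrow> 'a \<Rightarrow> 'a \<Rightarrow> ('a \<Rightarrow> 'a) \<Rightarrow> 'a" where
  "covariant_derivative S y X \<eta> =
     orthogonal_projection (tangent_space S y) (frechet_derivative \<eta> (at y) X)"

text \<open>
  \<open>\<eta>\<close> extends \<open>N\<close> to a smooth normal field of \<open>M\<close> in \<open>S\<close> near \<open>y\<close>. Off \<open>M\<close> its values are
  arbitrary, since every smooth normal field on \<open>M\<close> extends locally to the Euclidean space.
\<close>

definition normal_extension ::
    "'a::euclidean_space set \<Rightarrow> 'a set \<Rightarrow> 'a \<Rightarrow> 'a \<Rightarrow> ('a \<Rightarrow> 'a) \<Rightarrow> bool" where
  "normal_extension S M y N \<eta> \<longleftrightarrow>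
     \<eta> y = N \<and>
     (\<exists>U. y \<in> U \<and> smooth_on_open \<eta> U \<and> (\<forall>x\<in>U \<inter> M. \<eta> x \<in> normal_space_at S M x))"

text \<open>
  The Weingarten map \<open>S\<^sub>N X = - (\<nabla>\<^sub>X \<eta>)\<^sup>T\<close>, where \<open>\<^sup>T\<close> is the component tangent to \<open>M\<close>. For
  \<open>N\<close> normal and \<open>X\<close> tangent at \<open>y\<close> the result does not depend on the extension \<open>\<eta>\<close> of \<open>N\<close>.
\<close>

definition shape_operator ::
    "'a::euclidean_space set \<Rightarrow> 'a set \<Rightarrow> 'a \<Rightarrow> 'a \<Rightarrow> 'a \<Rightarrow> 'a" where
  "shape_operator S M y N X =
     (THE Z. \<exists>\<eta>. normal_extension S M y N \<eta> \<and>
        Z = - orthogonal_projection (tangent_space M y) (covariant_derivative S y X \<eta>))"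

definition shape_kernel ::
    "'a::euclidean_space set \<Rightarrow> 'a set \<Rightarrow> 'a \<Rightarrow> 'a \<Rightarrow> 'a set" where
  "shape_kernel S M y N = {X \<in> tangent_space M y. shape_operator S M y N X = 0}"

text \<open>\<open>E = U \<oplus> W\<close> for subspaces of a common vector space.\<close>

definition is_direct_sum :: "'a::real_vector set \<Rightarrow> 'a set \<Rightarrow> 'a set \<Rightarrow> bool" where
  "is_direct_sum E U W \<longleftrightarrow>
     subspace U \<and> subspace W \<and> E = {u + w |u w. u \<in> U \<and> w \<in> W} \<and> U \<inter> W = {0}"

end

(*
  At y in M_-, let P be the element of the Clifford sphere with P y = y. The tangent space of M_- is
  (E_+(P) minus R y) + {Q y | Q orthogonal to P}, and <S_N X, W> is obtained by differentiating the
  polynomial projection to the tangent spaces. One finds that ker S_N consists of the u in E_+(P)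
  orthogonal to y with <Q u, N> = 0 for all Q. Given u, a dimension count yields a normal N orthogonal
  to all Q u, so the kernels already cover the complement of y in E_+(P).

  Hence M_- determines the spaces E_+(P), and these determine the involutions P. To recover M_- from
  the unparametrised family, note that along unit speed normal great circles from M_- or M_+ the
  function f equals -cos 4t or cos 4t. Letting t tend to 0, any function that is constant on the
  levels is constant on each focal manifold. So two systems with the same family have the same M_-,
  or their focal manifolds are interchanged; the latter is impossible for m <= l - m - 1.
*)
theory Submission
  imports Defs
begin

section \<open>Smooth maps and tangent spaces\<close>

text \<open>The involution P fixing a point y of M_- is determined by y: its coefficients are <P_i
  y, y>. So E_+(P) can be written in terms of y alone, and elements of the Clifford span are handled
  as coefficient sequences. The shape operator is a \<open>THE\<close> over all normal extensions,
  so an extension must be exhibited and independence of its choice proved; explicit polynomial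
  projections serve both ends. The dimension counts share one principle. An involution Q orthogonal
  to P exchanges E_+(P) and E_-(P) (here m >= 1 enters), so both have dimension l. Hence a space W
  whose dimension exceeds that of its intersection with E_+(P) by less than l is orthogonal to a
  nonzero vector of E_-(P). The span of all P_i y and P_i u has dimension at most 2m + 2 and meets
  E_+(P) at least in the plane of y and u; the excess is at most 2m, less than l because 2m + 1 <=
  l. For interchanged focal manifolds the corresponding count is one short, and parity of l supplies
  the missing dimension.\<close>

lemma times_differentiable_on_mono:
  assumes "times_differentiable_on k f V" "U \<subseteq> V"
  shows "times_differentiable_on k f U"
  using assms by (induction k arbitrary: f) (auto intro: continuous_on_subset)

lemma times_differentiable_SucI:
  assumes "\<And>x. (f has_derivative f' x) (at x)"
    and "\<And>v. times_differentiable_on k (\<lambda>x. f' x v) UNIV"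
  shows "times_differentiable_on (Suc k) f UNIV"
proof -
  have "frechet_derivative f (at x) = f' x" for x
    using frechet_derivative_at[OF assms(1)] by simp
  then show ?thesis
    using assms by (auto simp: differentiable_def)
qed

lemma times_differentiable_SucE:
  assumes "times_differentiable_on (Suc k) f UNIV"
  obtains f' where "\<And>x. (f has_derivative f' x) (at x)"
    and "\<And>v. times_differentiable_on k (\<lambda>x. f' x v) UNIV"
  using assms that[of "\<lambda>x. frechet_derivative f (at x)"] by (auto simp: frechet_derivative_works)

lemma times_differentiable_on_lessD:
  assumes "times_differentiable_on (Suc k) f UNIV"
  shows "times_differentiable_on k f UNIV"
  using assms
proof (induction k arbitrary: f)
  case 0
  then show ?case
    by (auto intro!: continuous_at_imp_continuous_on differentiable_imp_continuous_within)
qed (metis times_differentiable_on.simps(2))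

lemma times_differentiable_on_const: "times_differentiable_on k (\<lambda>x. c) UNIV"
proof (induction k arbitrary: c)
  case (Suc k)
  show ?case
    by (rule times_differentiable_SucI[where f' = "\<lambda>x v. 0"]) (auto intro: Suc)
qed simp

lemma times_differentiable_on_add:
  assumes "times_differentiable_on k f UNIV" "times_differentiable_on k g UNIV"
  shows "times_differentiable_on k (\<lambda>x. f x + g x) UNIV"
  using assms
proof (induction k arbitrary: f g)
  case 0
  then show ?case by (simp add: continuous_on_add)
next
  case (Suc k)
  from Suc.prems obtain f' g' where
    "\<And>x. (f has_derivative f' x) (at x)" "\<And>v. times_differentiable_on k (\<lambda>x. f' x v) UNIV"
    "\<And>x. (g has_derivative g' x) (at x)" "\<And>v. times_differentiable_on k (\<lambda>x. g' x v) UNIV"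
    by (metis times_differentiable_SucE)
  then show ?case
    by (intro times_differentiable_SucI[where f' = "\<lambda>x v. f' x v + g' x v"])
       (auto intro!: has_derivative_add Suc.IH)
qed

text \<open>The derivative is a sum of two products, each with one undifferentiated factor, whose
  order has to be lowered by one. A general bounded bilinear map covers scaling, inner products and
  multiplication at once.\<close>

lemma times_differentiable_on_bilinear:
  assumes "bounded_bilinear B"
    and "times_differentiable_on k f UNIV" "times_differentiable_on k g UNIV"
  shows "times_differentiable_on k (\<lambda>x. B (f x) (g x)) UNIV"
  using assms(2,3)
proof (induction k arbitrary: f g)
  case 0
  then show ?case by (simp add: bounded_bilinear.continuous_on[OF assms(1)])
next
  case (Suc k)
  from Suc.prems obtain f' g' where
    "\<And>x. (f has_derivative f' x) (at x)" "\<And>v. times_differentiable_on k (\<lambda>x. f' x v) UNIV"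
    "\<And>x. (g has_derivative g' x) (at x)" "\<And>v. times_differentiable_on k (\<lambda>x. g' x v) UNIV"
    by (metis times_differentiable_SucE)
  then show ?case
    by (intro times_differentiable_SucI[where f' = "\<lambda>x v. B (f x) (g' x v) + B (f' x v) (g x)"])
       (auto intro!: bounded_bilinear.FDERIV[OF assms(1)] times_differentiable_on_add Suc.IH
          times_differentiable_on_lessD[OF Suc.prems(1)] times_differentiable_on_lessD[OF Suc.prems(2)])
qed

lemma times_differentiable_on_linear:
  assumes "bounded_linear f"
  shows "times_differentiable_on k f UNIV"
proof (cases k)
  case 0
  then show ?thesis by (simp add: assms linear_continuous_on)
next
  case (Suc j)
  show ?thesis unfolding Suc
    by (rule times_differentiable_SucI[where f' = "\<lambda>x. f"])
       (auto intro: times_differentiable_on_const bounded_linear_imp_has_derivative assms)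
qed

lemma smooth_on_open_UNIV_imp:
  "smooth_on_open f UNIV \<Longrightarrow> open U \<Longrightarrow> smooth_on_open f U"
  by (auto simp: smooth_on_open_def intro: times_differentiable_on_mono)

lemma smooth_const: "smooth_on_open (\<lambda>x. c) UNIV"
  by (simp add: smooth_on_open_def times_differentiable_on_const)

lemma smooth_linear: "bounded_linear f \<Longrightarrow> smooth_on_open f UNIV"
  by (simp add: smooth_on_open_def times_differentiable_on_linear)

lemma smooth_add:
  "smooth_on_open f UNIV \<Longrightarrow> smooth_on_open g UNIV \<Longrightarrow> smooth_on_open (\<lambda>x. f x + g x) UNIV"
  by (simp add: smooth_on_open_def times_differentiable_on_add)

lemma smooth_bilinear:
  "bounded_bilinear B \<Longrightarrow> smooth_on_open f UNIV \<Longrightarrow> smooth_on_open g UNIV \<Longrightarrow>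
     smooth_on_open (\<lambda>x. B (f x) (g x)) UNIV"
  by (simp add: smooth_on_open_def times_differentiable_on_bilinear)

lemmas smooth_scaleR = smooth_bilinear[OF bounded_bilinear_scaleR]
lemmas smooth_inner = smooth_bilinear[OF bounded_bilinear_inner]

lemma smooth_diff:
  assumes "smooth_on_open f UNIV" "smooth_on_open g UNIV"
  shows "smooth_on_open (\<lambda>x. f x - g x) UNIV"
  using smooth_add[OF assms(1) smooth_scaleR[OF smooth_const assms(2), of "-1"]] by simp

lemma smooth_sum:
  assumes "\<And>i. i \<in> I \<Longrightarrow> smooth_on_open (f i) UNIV"
  shows "smooth_on_open (\<lambda>x. \<Sum>i\<in>I. f i x) UNIV"
  using assms by (induction I rule: infinite_finite_induct) (auto intro: smooth_const smooth_add)

text \<open>Amplitude and phase are arbitrary so that the family is closed under differentiation,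
  which shifts the phase by \<open>pi / 2\<close> and rescales the amplitude. Cosine is the phase
  \<open>pi / 2\<close>.\<close>

lemma times_differentiable_on_sin:
  "times_differentiable_on k (\<lambda>t::real. r * sin (a * t + b)) UNIV"
proof (induction k arbitrary: r b)
  case 0
  then show ?case by (auto intro!: continuous_intros)
next
  case (Suc k)
  show ?case
  proof (rule times_differentiable_SucI)
    show "((\<lambda>t. r * sin (a * t + b)) has_derivative (\<lambda>s. (r * a * s) * sin (a * t + (b + pi / 2)))) (at t)" for t
      by (auto intro!: derivative_eq_intros simp: sin_add cos_add fun_eq_iff algebra_simps)
  qed (rule Suc)
qed

lemma smooth_sin: "smooth_on_open (\<lambda>t::real. sin (a * t)) UNIV"
  using times_differentiable_on_sin[of _ 1 a 0] by (simp add: smooth_on_open_def)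

lemma smooth_cos: "smooth_on_open (\<lambda>t::real. cos (a * t)) UNIV"
  using times_differentiable_on_sin[of _ 1 a "pi / 2"] by (simp add: smooth_on_open_def sin_add)

section \<open>Tangent spaces and orthogonal projections\<close>

lemma smooth_on_open_has_derivative:
  assumes "smooth_on_open f U" "x \<in> U"
  shows "(f has_derivative frechet_derivative f (at x)) (at x)"
proof -
  have "times_differentiable_on 1 f U" using assms by (simp add: smooth_on_open_def)
  then show ?thesis using assms by (simp add: frechet_derivative_works)
qed

text \<open>Chain rule along a curve in \<open>M\<close>: composed with it, \<open>f\<close>
  vanishes for all parameters near 0. Every upper bound on a tangent space and the Weingarten
  formula come from this.\<close>

lemma tangent_space_annihilator:
  assumes v: "v \<in> tangent_space M y" and D: "(f has_derivative D) (at y)"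
    and U: "open U" "y \<in> U" and z: "\<And>x. x \<in> U \<inter> M \<Longrightarrow> f x = 0"
  shows "D v = 0"
proof -
  from v obtain c e where ce: "e > 0" "\<forall>t\<in>{-e<..<e}. c t \<in> M" "c 0 = y"
    and c': "(c has_vector_derivative v) (at 0)"
    unfolding tangent_space_def by blast
  have fc: "((\<lambda>t. f (c t)) has_derivative (\<lambda>t. D (t *\<^sub>R v))) (at 0)"
    using has_derivative_compose[OF c'[unfolded has_vector_derivative_def], of f D] D ce(3) by simp
  have "continuous (at 0) c" using c' by (rule has_vector_derivative_continuous)
  then have "\<forall>\<^sub>F t in at 0. c t \<in> U"
    using U ce(3) by (auto simp: continuous_at intro: topological_tendstoD)
  then have c_in_U: "\<forall>\<^sub>F t in nhds 0. c t \<in> U"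
    using U ce(3) by (auto simp: eventually_nhds_conv_at)
  have "\<forall>\<^sub>F t in nhds (0::real). t \<in> {-e<..<e}"
    using ce(1) by (intro eventually_nhds_in_open) auto
  with c_in_U have "\<forall>\<^sub>F t in nhds 0. f (c t) = 0"
    by (rule eventually_elim2) (use ce z in auto)
  with fc have "((\<lambda>t. 0) has_derivative (\<lambda>t. D (t *\<^sub>R v))) (at (0::real))"
    using ce(3) U z has_derivative_transform_eventually[of "\<lambda>t. f (c t)" _ 0 UNIV "\<lambda>t. 0"]
    by (auto simp: eventually_nhds_conv_at)
  then have "(\<lambda>t. D (t *\<^sub>R v)) = (\<lambda>t. 0)"
    by (rule has_derivative_unique) simp
  then show ?thesis by (metis scaleR_one)
qed

lemma tangent_spaceI:
  assumes "smooth_on_open c UNIV" "\<And>t. c t \<in> M" "c 0 = y" "(c has_vector_derivative v) (at 0)"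
  shows "v \<in> tangent_space M y"
  unfolding tangent_space_def using assms smooth_on_open_UNIV_imp[OF assms(1), of "{-1<..<1}"]
  by (auto intro!: exI[of _ c] exI[of _ 1])

text \<open>Dividing by \<open>norm u\<close> gives the circle the initial velocity \<open>u\<close>
  for a direction of any length; for \<open>u = 0\<close> the convention \<open>x / 0 = 0\<close>
  makes it constant at \<open>y\<close>.\<close>

lemma great_circle_in_sphere:
  fixes y u :: "'a::euclidean_space"
  assumes "norm y = 1" "y \<bullet> u = 0"
  shows "norm (cos (norm u * t) *\<^sub>R y + (sin (norm u * t) / norm u) *\<^sub>R u) = 1"
proof -
  define a b where "a = cos (norm u * t)" and "b = sin (norm u * t) / norm u"
  have "a\<^sup>2 + b\<^sup>2 * (u \<bullet> u) = 1"
    by (cases "u = 0") (auto simp: a_def b_def power_divide power2_norm_eq_inner)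
  moreover have "(a *\<^sub>R y + b *\<^sub>R u) \<bullet> (a *\<^sub>R y + b *\<^sub>R u) = a\<^sup>2 + b\<^sup>2 * (u \<bullet> u)"
    using assms by (simp add: norm_eq_1 inner_commute[of u y] inner_right_distrib inner_left_distrib power2_eq_square)
  ultimately show ?thesis by (simp add: a_def b_def norm_eq_1)
qed

lemma tangent_space_sphere:
  fixes y :: "'a::euclidean_space"
  assumes "norm y = 1"
  shows "tangent_space (sphere 0 1) y = {v. y \<bullet> v = 0}"
proof (intro set_eqI iffI; simp)
  fix v assume "v \<in> tangent_space (sphere 0 1) y"
  then have "2 * (y \<bullet> v) = 0"
    by (rule tangent_space_annihilator[where f = "\<lambda>x. x \<bullet> x - 1" and U = UNIV and D = "\<lambda>v. 2 * (y \<bullet> v)"])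
       (auto intro!: derivative_eq_intros simp: inner_commute dot_square_norm)
  then show "y \<bullet> v = 0" by simp
next
  fix v assume v: "y \<bullet> v = 0"
  show "v \<in> tangent_space (sphere 0 1) y"
  proof (rule tangent_spaceI)
    let ?c = "\<lambda>t. cos (norm v * t) *\<^sub>R y + (sin (norm v * t) * (1 / norm v)) *\<^sub>R v"
    show "smooth_on_open ?c UNIV"
      by (intro smooth_add smooth_scaleR smooth_bilinear[OF bounded_bilinear_mult]
            smooth_const smooth_cos smooth_sin)
    show "?c t \<in> sphere 0 1" for t
      using great_circle_in_sphere[OF assms v] by simp
    show "(?c has_vector_derivative v) (at 0)"
      by (cases "v = 0") (auto intro!: derivative_eq_intros)
  qed simp
qed

lemma orthogonal_projection:
  fixes V :: "'a::euclidean_space set"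
  assumes "subspace V"
  shows "orthogonal_projection V x \<in> V" "v \<in> V \<Longrightarrow> orthogonal_projection V x \<bullet> v = x \<bullet> v"
proof -
  obtain p z where p: "p \<in> V" "\<And>w. w \<in> V \<Longrightarrow> orthogonal z w" "x = p + z"
    using orthogonal_subspace_decomp_exists[of V x] span_eq_iff[of V] assms by metis
  have "\<exists>!p. p \<in> V \<and> (\<forall>v\<in>V. orthogonal (x - p) v)"
  proof (rule ex1I)
    show "p \<in> V \<and> (\<forall>v\<in>V. orthogonal (x - p) v)" using p by simp
  next
    fix q assume q: "q \<in> V \<and> (\<forall>v\<in>V. orthogonal (x - q) v)"
    then have "q - p \<in> V" using p assms subspace_diff by blast
    then have "(x - q) \<bullet> (q - p) = 0" "(x - p) \<bullet> (q - p) = 0"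
      using p q by (auto simp: orthogonal_def)
    then have "(q - p) \<bullet> (q - p) = 0" by (simp add: inner_diff_left inner_diff_right)
    then show "q = p" by simp
  qed
  from theI'[OF this, folded orthogonal_projection_def]
  show "orthogonal_projection V x \<in> V" "v \<in> V \<Longrightarrow> orthogonal_projection V x \<bullet> v = x \<bullet> v"
    by (auto simp: orthogonal_def inner_diff_left)
qed

lemma norm_cos_sin:
  fixes y z :: "'a::real_inner"
  assumes "norm y = 1" "norm z = 1" "y \<bullet> z = 0"
  shows "norm (cos t *\<^sub>R y + sin t *\<^sub>R z) = 1"
  using assms
  by (simp add: norm_eq_1 inner_add_left inner_add_right inner_commute[of z y] flip: power2_eq_square)

section \<open>Clifford systems acting on vectors\<close>

lemma sum_coordinate_scaleR:
  "finite I \<Longrightarrow> j \<in> I \<Longrightarrow> (\<Sum>i\<in>I. (if i = j then 1 else 0 :: real) *\<^sub>R f i) = (f j :: 'a::real_vector)"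
  by (simp add: if_distrib[of "\<lambda>c. c *\<^sub>R _"] cong: if_cong)

locale clifford =
  fixes m :: nat and P :: "nat \<Rightarrow> real^'n^'n"
  assumes clifford_system: "clifford_system m P"
begin

text \<open>Elements of the Clifford span are represented by coefficient sequences, of which only
  the entries up to \<open>m\<close> count: \<open>comb\<close> gives the matrix, \<open>act\<close>
  its action on a vector, and \<open>ip\<close> becomes \<open>endo_inner\<close>.\<close>

definition comb :: "(nat \<Rightarrow> real) \<Rightarrow> real^'n^'n" where
  "comb c = (\<Sum>i\<le>m. c i *\<^sub>R P i)"

definition act :: "(nat \<Rightarrow> real) \<Rightarrow> real^'n \<Rightarrow> real^'n" where
  "act c x = (\<Sum>i\<le>m. c i *\<^sub>R (P i *v x))"

definition ip :: "(nat \<Rightarrow> real) \<Rightarrow> (nat \<Rightarrow> real) \<Rightarrow> real" where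
  "ip c d = (\<Sum>i\<le>m. c i * d i)"

text \<open>For fixed \<open>x\<close> this is the adjoint of the map from \<open>c\<close> to
  \<open>act c x\<close>. For \<open>x\<close> in M_- the sequence \<open>Pcoeffs x x\<close>
  represents the involution that fixes \<open>x\<close>.\<close>

definition Pcoeffs :: "real^'n \<Rightarrow> real^'n \<Rightarrow> nat \<Rightarrow> real" where
  "Pcoeffs x v i = (P i *v x) \<bullet> v"

lemma m_ge_1: "1 \<le> m"
  using clifford_system by (simp add: clifford_system_def)

lemma comb_mult_vec: "comb c *v x = act c x"
proof -
  have "(\<Sum>i\<in>I. c i *\<^sub>R P i) *v x = (\<Sum>i\<in>I. c i *\<^sub>R (P i *v x))" if "finite I" for I
    using that by induction (auto simp: matrix_vector_mult_add_rdistrib scaleR_matrix_vector_assoc)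
  then show ?thesis by (simp add: comb_def act_def)
qed

lemma P_inner: "i \<le> m \<Longrightarrow> (P i *v x) \<bullet> y = x \<bullet> (P i *v y)"
  using clifford_system by (metis clifford_system_def dot_lmul_matrix vector_transpose_matrix)

lemma P_anticommute:
  assumes "i \<le> m" "j \<le> m"
  shows "P i *v (P j *v x) + P j *v (P i *v x) = (if i = j then 2 else 0) *\<^sub>R x"
proof -
  have "(P i ** P j + P j ** P i) *v x = (if i = j then 2 *\<^sub>R mat 1 else 0) *v x"
    using clifford_system assms by (simp add: clifford_system_def)
  then show ?thesis
    by (auto simp: matrix_vector_mult_add_rdistrib matrix_vector_mul_assoc[symmetric]
        scaleR_matrix_vector_assoc[symmetric] split: if_splits)
qed

lemma linear_act: "linear (act c)"
  unfolding act_def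
  by (intro linear_compose_sum ballI linear_compose_scale_right) (simp_all add: matrix_vector_mul_linear)

lemmas act_simps = linear_add[OF linear_act] linear_diff[OF linear_act] linear_cmul[OF linear_act]
  linear_0[OF linear_act] linear_neg[OF linear_act] linear_sum[OF linear_act]

lemma act_coeff_add: "act (\<lambda>i. c i + d i) x = act c x + act d x"
  by (simp add: act_def scaleR_add_left sum.distrib)

lemma act_coeff_scale: "act (\<lambda>i. r * c i) x = r *\<^sub>R act c x"
  by (simp add: act_def scaleR_sum_right)

lemma ip_commute: "ip c d = ip d c"
  by (simp add: ip_def mult.commute)

lemma ip_scale_left: "ip (\<lambda>i. r * c i) d = r * ip c d"
  by (simp add: ip_def sum_distrib_left mult.assoc)

lemma ip_scale_right: "ip d (\<lambda>i. r * c i) = r * ip d c"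
  by (simp add: ip_def sum_distrib_left algebra_simps)

lemma ip_add_left: "ip (\<lambda>i. c i + d i) e = ip c e + ip d e"
  by (simp add: ip_def sum.distrib algebra_simps)

lemma ip_add_right: "ip e (\<lambda>i. c i + d i) = ip e c + ip e d"
  by (simp add: ip_def sum.distrib algebra_simps)

lemma ip_self_nonneg: "0 \<le> ip c c"
  by (simp add: ip_def sum_nonneg)

lemma ip_self_eq_0: "ip c c = 0 \<Longrightarrow> i \<le> m \<Longrightarrow> c i = 0"
  by (simp add: ip_def sum_nonneg_eq_0_iff)

lemma act_eq_0: "ip c c = 0 \<Longrightarrow> act c x = 0"
  unfolding act_def by (rule sum.neutral) (simp add: ip_self_eq_0)

lemma act_inner: "act c x \<bullet> y = x \<bullet> act c y"
  by (simp add: act_def inner_sum_left inner_sum_right P_inner)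

lemma act_inner_Pcoeffs: "act c x \<bullet> y = ip c (Pcoeffs x y)"
  by (simp add: act_def ip_def Pcoeffs_def inner_sum_left)

lemma act_anticommute: "act c (act d x) + act d (act c x) = (2 * ip c d) *\<^sub>R x"
proof -
  have cd: "act c (act d x) = (\<Sum>i\<le>m. \<Sum>j\<le>m. (c i * d j) *\<^sub>R (P i *v (P j *v x)))" for c d
    by (simp add: act_def scaleR_sum_right linear_sum[OF matrix_vector_mul_linear]
        linear_cmul[OF matrix_vector_mul_linear])
  have "act d (act c x) = (\<Sum>i\<le>m. \<Sum>j\<le>m. (c i * d j) *\<^sub>R (P j *v (P i *v x)))"
    unfolding cd by (subst sum.swap) (simp add: mult.commute)
  then have "act c (act d x) + act d (act c x)
    = (\<Sum>i\<le>m. \<Sum>j\<le>m. (c i * d j) *\<^sub>R (P i *v (P j *v x) + P j *v (P i *v x)))"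
    unfolding cd by (simp add: sum.distrib scaleR_add_right)
  also have "\<dots> = (\<Sum>i\<le>m. \<Sum>j\<le>m. (if i = j then (2 * (c i * d i)) *\<^sub>R x else 0))"
    by (intro sum.cong refl) (simp add: P_anticommute)
  also have "\<dots> = (2 * ip c d) *\<^sub>R x"
    by (simp add: ip_def sum_distrib_left scaleR_sum_left)
  finally show ?thesis .
qed

lemma act_act: "act c (act c x) = ip c c *\<^sub>R x"
proof -
  have "2 *\<^sub>R act c (act c x) = (2 * ip c c) *\<^sub>R x"
    using act_anticommute[of c c x] by (simp add: scaleR_2)
  then have "(1/2) *\<^sub>R (2 *\<^sub>R act c (act c x)) = (1/2) *\<^sub>R ((2 * ip c c) *\<^sub>R x)"
    by (rule arg_cong)
  then show ?thesis by simp
qed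

lemma act_swap: "act c (act d x) = (2 * ip c d) *\<^sub>R x - act d (act c x)"
  using act_anticommute[of c d x] by (simp add: algebra_simps)

lemma act_inner_act: "act c x \<bullet> act d x = ip c d * (x \<bullet> x)"
proof -
  have "2 * (act c x \<bullet> act d x) = x \<bullet> (act c (act d x) + act d (act c x))"
    using act_inner[of c x "act d x"] act_inner[of d x "act c x"]
    by (simp add: inner_add_right inner_commute[of "act d x"])
  then show ?thesis by (simp add: act_anticommute)
qed

lemma norm_act: "(norm (act c x))\<^sup>2 = ip c c * (x \<bullet> x)"
  by (simp add: power2_norm_eq_inner act_inner_act)

lemma P_eq_act: "i \<le> m \<Longrightarrow> P i *v x = act (\<lambda>j. if j = i then 1 else 0) x"
  by (simp add: act_def sum_coordinate_scaleR)

lemma act_inner_P: "j \<le> m \<Longrightarrow> act c x \<bullet> (P j *v x) = c j * (x \<bullet> x)"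
  by (simp add: P_eq_act act_inner_act) (simp add: ip_def if_distrib cong: if_cong)

lemma Pcoeffs_act: "j \<le> m \<Longrightarrow> Pcoeffs x (act c x) j = c j * (x \<bullet> x)"
  by (simp add: Pcoeffs_def act_inner_P inner_commute[of _ "act c x"])

lemma ip_cong: "(\<And>i. i \<le> m \<Longrightarrow> c i = c' i) \<Longrightarrow> (\<And>i. i \<le> m \<Longrightarrow> d i = d' i) \<Longrightarrow> ip c d = ip c' d'"
  by (simp add: ip_def)

lemma act_cong: "(\<And>i. i \<le> m \<Longrightarrow> c i = c' i) \<Longrightarrow> act c x = act c' x"
  by (simp add: act_def)

text \<open>With h = \<open>Pcoeffs x x\<close>, Cauchy-Schwarz gives |h|^2 = <h x, x> <= |h x| =
  |h|. This is the bound F >= -1 on the sphere, and M_- is the case of equality.\<close>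

lemma Pcoeffs_ip_le:
  assumes "norm x = 1"
  shows "ip (Pcoeffs x x) (Pcoeffs x x) \<le> 1"
proof -
  let ?h = "Pcoeffs x x"
  have "ip ?h ?h = act ?h x \<bullet> x" by (simp add: act_inner_Pcoeffs)
  also have "\<dots> \<le> norm (act ?h x)" using norm_cauchy_schwarz[of "act ?h x" x] assms by simp
  finally have "(ip ?h ?h)\<^sup>2 \<le> (norm (act ?h x))\<^sup>2" by (simp add: ip_self_nonneg power_mono)
  also have "\<dots> = ip ?h ?h" using assms by (simp add: norm_act norm_eq_1)
  finally show ?thesis
    using ip_self_nonneg[of ?h] by (cases "ip ?h ?h = 0") (auto simp: power2_eq_square)
qed

lemma clifford_F_eq: "norm x = 1 \<Longrightarrow> clifford_F m P x = 1 - 2 * ip (Pcoeffs x x) (Pcoeffs x x)"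
  by (simp add: clifford_F_def ip_def Pcoeffs_def norm_eq_1 power2_eq_square)

lemma M_minus_iff_ip: "x \<in> M_minus m P \<longleftrightarrow> norm x = 1 \<and> ip (Pcoeffs x x) (Pcoeffs x x) = 1"
  by (auto simp: M_minus_def level_def clifford_F_eq)

text \<open>The equality case of Cauchy-Schwarz: \<open>act (Pcoeffs x x) x\<close> and
  \<open>x\<close> are unit vectors with inner product 1.\<close>

lemma M_minus_act:
  assumes "x \<in> M_minus m P"
  shows "act (Pcoeffs x x) x = x"
proof -
  have "norm x = 1" "ip (Pcoeffs x x) (Pcoeffs x x) = 1" using assms by (auto simp: M_minus_iff_ip)
  moreover have "act (Pcoeffs x x) x \<bullet> x = ip (Pcoeffs x x) (Pcoeffs x x)"
    by (rule act_inner_Pcoeffs)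
  ultimately have "(act (Pcoeffs x x) x - x) \<bullet> (act (Pcoeffs x x) x - x) = 0"
    by (simp add: inner_diff_left inner_diff_right act_inner_act norm_eq_1
        inner_commute[of x "act (Pcoeffs x x) x"])
  then show ?thesis by simp
qed

text \<open>Pairing \<open>act c x = x\<close> with the orthonormal vectors P_i x reads off the
  coefficients, so at most one element of the span fixes \<open>x\<close>.\<close>

lemma Pcoeffs_eq_of_act_eq:
  assumes "norm x = 1" "act c x = x" "i \<le> m"
  shows "Pcoeffs x x i = c i"
  using Pcoeffs_act[of i x c] assms by (simp add: norm_eq_1)

lemma M_minusI:
  assumes "norm x = 1" "act c x = x" "ip c c = 1"
  shows "x \<in> M_minus m P"
  using assms Pcoeffs_eq_of_act_eq[OF assms(1,2)] ip_cong[of "Pcoeffs x x" c "Pcoeffs x x" c]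
  by (simp add: M_minus_iff_ip)

end

section \<open>Tangent and normal spaces of the focal manifold\<close>

context clifford begin

text \<open>
  The unit vectors \<open>x \<in> M\<^sub>-\<close> are those fixed by \<open>\<Sum>\<langle>P\<^sub>i x, x\<rangle> P\<^sub>i\<close>; differentiating this cubic equation
  gives the second condition below.
\<close>

definition tangent_M :: "real^'n \<Rightarrow> (real^'n) set" where
  "tangent_M y = {v. y \<bullet> v = 0 \<and> v - act (Pcoeffs y y) v = 2 *\<^sub>R act (Pcoeffs y v) y}"

definition normal_M :: "real^'n \<Rightarrow> (real^'n) set" where
  "normal_M y = {v. act (Pcoeffs y y) v = - v \<and> (\<forall>c. act c y \<bullet> v = 0)}"

lemma Pcoeffs_add: "Pcoeffs x (v + w) = (\<lambda>i. Pcoeffs x v i + Pcoeffs x w i)"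
  by (simp add: Pcoeffs_def inner_add_right fun_eq_iff)

lemma Pcoeffs_scale: "Pcoeffs x (r *\<^sub>R v) = (\<lambda>i. r * Pcoeffs x v i)"
  by (simp add: Pcoeffs_def fun_eq_iff)

lemma Pcoeffs_0: "Pcoeffs x 0 = (\<lambda>i. 0)"
  by (simp add: Pcoeffs_def fun_eq_iff)

lemma act_coeffs_0: "act (\<lambda>i. 0) x = 0"
  by (simp add: act_def)

lemma subspace_tangent_M: "subspace (tangent_M y)"
proof (rule subspaceI)
  show "0 \<in> tangent_M y" by (simp add: tangent_M_def act_simps Pcoeffs_0 act_coeffs_0)
next
  fix v w assume vw: "v \<in> tangent_M y" "w \<in> tangent_M y"
  have "v + w - act (Pcoeffs y y) (v + w) = (v - act (Pcoeffs y y) v) + (w - act (Pcoeffs y y) w)"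
    by (simp add: act_simps)
  with vw show "v + w \<in> tangent_M y"
    by (simp add: tangent_M_def Pcoeffs_add act_coeff_add scaleR_add_right inner_add_right)
next
  fix r v assume v: "v \<in> tangent_M y"
  have "r *\<^sub>R v - act (Pcoeffs y y) (r *\<^sub>R v) = r *\<^sub>R (v - act (Pcoeffs y y) v)"
    by (simp add: act_simps scaleR_diff_right)
  with v show "r *\<^sub>R v \<in> tangent_M y"
    by (simp add: tangent_M_def Pcoeffs_scale act_coeff_scale)
qed

lemma M_minusD:
  assumes "y \<in> M_minus m P"
  shows "norm y = 1" "y \<bullet> y = 1" "ip (Pcoeffs y y) (Pcoeffs y y) = 1" "act (Pcoeffs y y) y = y"
  using assms M_minus_act[OF assms] by (auto simp: M_minus_iff_ip norm_eq_1)

text \<open>A unit Q orthogonal to P anticommutes with P. Rotating z by \<theta> in the plane of z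
  and Q z therefore matches rotating P by 2 \<theta> towards Q; \<open>?e\<close> holds the
  coefficients of the rotated involution.\<close>

lemma rotate_in_M_minus:
  assumes z: "norm z = 1" "act c z = z" "ip c c = 1" and d: "ip c d = 0" "ip d d = 1"
  shows "cos \<theta> *\<^sub>R z + sin \<theta> *\<^sub>R act d z \<in> M_minus m P"
proof (rule M_minusI)
  let ?w = "cos \<theta> *\<^sub>R z + sin \<theta> *\<^sub>R act d z"
  let ?e = "\<lambda>i. cos (2 * \<theta>) * c i + sin (2 * \<theta>) * d i"
  have cd: "act c (act d z) = - act d z" using act_swap[of c d z] z d by simp
  have "z \<bullet> act d z = 0"
    using act_inner_act[of c z d] z d by simp
  then have "?w \<bullet> ?w = (cos \<theta>)\<^sup>2 + (sin \<theta>)\<^sup>2"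
    using z d by (simp add: inner_add_left inner_add_right act_inner_act norm_eq_1 power2_eq_square
        inner_commute[of "act d z"])
  then show "norm ?w = 1" by (simp add: norm_eq_1)
  have "act ?e ?w = (cos (2 * \<theta>) * cos \<theta> + sin (2 * \<theta>) * sin \<theta>) *\<^sub>R z
      + (sin (2 * \<theta>) * cos \<theta> - cos (2 * \<theta>) * sin \<theta>) *\<^sub>R act d z"
    unfolding act_coeff_add act_coeff_scale
    using z d cd by (simp add: act_simps act_act algebra_simps)
  also have "\<dots> = cos (2 * \<theta> - \<theta>) *\<^sub>R z + sin (2 * \<theta> - \<theta>) *\<^sub>R act d z"
    by (simp only: cos_diff sin_diff)
  finally show "act ?e ?w = ?w" by simp
  show "ip ?e ?e = 1"
    using z d by (simp add: ip_add_left ip_add_right ip_scale_left ip_scale_right ip_commute[of d c]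
        flip: power2_eq_square)
qed

text \<open>A vector v of \<open>tangent_M y\<close> splits as u + Q y with u in E_+(P) and Q
  orthogonal to P. The curve moves y along a great circle in E_+(P) with velocity u and meanwhile
  rotates it by Q as in \<open>rotate_in_M_minus\<close>.\<close>

lemma tangent_M_subset:
  assumes y: "y \<in> M_minus m P"
  shows "tangent_M y \<subseteq> tangent_space (M_minus m P) y"
proof
  fix v assume v: "v \<in> tangent_M y"
  define c where "c = Pcoeffs y y"
  define d where "d = Pcoeffs y v"
  have c: "norm y = 1" "ip c c = 1" "act c y = y" using M_minusD[OF y] by (simp_all add: c_def)
  have yv: "y \<bullet> v = 0" "v - act c v = 2 *\<^sub>R act d y" using v by (simp_all add: tangent_M_def c_def d_def)
  have cd: "ip c d = 0" using yv c act_inner_Pcoeffs[of c y v] by (simp add: d_def)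
  define u where "u = v - act d y"
  have cdy: "act c (act d y) = - act d y" using act_swap[of c d y] c cd by simp
  have cu: "act c u = u"
    using yv(2) cdy by (simp add: u_def act_simps algebra_simps scaleR_2)
  have yu: "y \<bullet> u = 0"
    using act_inner_act[of c y d] c cd yv by (simp add: u_def inner_diff_right)
  define a where "a = sqrt (ip d d)"
  define z where "z t = cos (norm u * t) *\<^sub>R y + (sin (norm u * t) * (1 / norm u)) *\<^sub>R u" for t
  have z: "norm (z t) = 1" "act c (z t) = z t" for t
    using great_circle_in_sphere[OF c(1) yu] by (simp_all add: z_def act_simps c cu)
  let ?c = "\<lambda>t. cos (a * t) *\<^sub>R z t + (sin (a * t) * (1 / a)) *\<^sub>R act d (z t)"
  show "v \<in> tangent_space (M_minus m P) y"
  proof (rule tangent_spaceI)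
    have sz: "smooth_on_open z UNIV"
      unfolding z_def
      by (intro smooth_add smooth_scaleR smooth_bilinear[OF bounded_bilinear_mult]
            smooth_const smooth_cos smooth_sin)
    have sd: "smooth_on_open (\<lambda>t. act d (z t)) UNIV"
      unfolding z_def act_simps
      by (intro smooth_add smooth_scaleR smooth_bilinear[OF bounded_bilinear_mult]
            smooth_const smooth_cos smooth_sin)
    show "smooth_on_open ?c UNIV"
      by (intro smooth_add smooth_scaleR smooth_bilinear[OF bounded_bilinear_mult]
            smooth_const smooth_cos smooth_sin sz sd)
    show "?c t \<in> M_minus m P" for t
    \<comment> \<open>If Q = 0, only \<open>z t\<close> is left, which lies in E_+(P); otherwise
      dividing \<open>d\<close> by \<open>a\<close> gives the unit coefficients that the rotation
      requires.\<close>
    proof (cases "a = 0")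
      case True
      then show ?thesis using M_minusI[OF z c(2)] by simp
    next
      case False
      then have "ip d d > 0" using ip_self_nonneg[of d] by (auto simp: a_def)
      then have "ip (\<lambda>i. 1 / a * d i) (\<lambda>i. 1 / a * d i) = 1" "ip c (\<lambda>i. 1 / a * d i) = 0"
        unfolding ip_scale_left ip_scale_right using cd by (simp_all add: a_def)
      from rotate_in_M_minus[OF z c(2) this(2,1), of "a * t" t]
      show ?thesis unfolding act_coeff_scale by simp
    qed
    show "?c 0 = y" by (simp add: z_def)
    have z': "(z has_vector_derivative u) (at 0)"
      unfolding z_def by (cases "u = 0") (auto intro!: derivative_eq_intros)
    have "(?c has_vector_derivative u + act d y) (at 0)" if "a \<noteq> 0"
      unfolding z_def act_simps using that
      by (cases "u = 0") (auto intro!: derivative_eq_intros simp: act_simps)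
    moreover have "act d y = 0" if "a = 0"
      using that act_eq_0[of d] ip_self_nonneg[of d] by (simp add: a_def)
    ultimately show "(?c has_vector_derivative v) (at 0)"
      using z' by (cases "a = 0") (auto simp: u_def)
  qed
qed

lemma has_derivative_Pcoeffs:
  "((\<lambda>x. Pcoeffs x x i) has_derivative (\<lambda>v. 2 * Pcoeffs y v i)) (at y)" if "i \<le> m"
proof -
  have "((\<lambda>x. Pcoeffs x x i) has_derivative (\<lambda>v. (P i *v y) \<bullet> v + (P i *v v) \<bullet> y)) (at y)"
    unfolding Pcoeffs_def
    by (auto intro!: derivative_eq_intros bounded_linear_imp_has_derivative)
  moreover have "(P i *v v) \<bullet> y = (P i *v y) \<bullet> v" for v
    using P_inner[OF that] by (simp add: inner_commute)
  ultimately show ?thesis by (simp add: Pcoeffs_def)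
qed

lemma has_derivative_act_Pcoeffs:
  "((\<lambda>x. act (Pcoeffs x x) w) has_derivative (\<lambda>v. 2 *\<^sub>R act (Pcoeffs y v) w)) (at y)"
  unfolding act_def
  by (auto intro!: derivative_eq_intros has_derivative_Pcoeffs simp: scaleR_sum_right)

lemma has_derivative_cubic:
  "((\<lambda>x. act (Pcoeffs x x) x) has_derivative
     (\<lambda>v. act (Pcoeffs y y) v + 2 *\<^sub>R act (Pcoeffs y v) y)) (at y)"
  unfolding act_def
  by (auto intro!: derivative_eq_intros has_derivative_Pcoeffs bounded_linear_imp_has_derivative
      simp: scaleR_sum_right sum.distrib)

lemma tangent_space_M_minus:
  assumes y: "y \<in> M_minus m P"
  shows "tangent_space (M_minus m P) y = tangent_M y"
proof
  show "tangent_space (M_minus m P) y \<subseteq> tangent_M y"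
  proof
    fix v assume v: "v \<in> tangent_space (M_minus m P) y"
    have "2 * (y \<bullet> v) = 0"
      using v by (rule tangent_space_annihilator[where f = "\<lambda>x. x \<bullet> x - 1" and U = UNIV and D = "\<lambda>v. 2 * (y \<bullet> v)"])
        (auto intro!: derivative_eq_intros simp: inner_commute M_minusD)
    moreover have "act (Pcoeffs y y) v + 2 *\<^sub>R act (Pcoeffs y v) y - v = 0"
      using v by (rule tangent_space_annihilator[where f = "\<lambda>x. act (Pcoeffs x x) x - x" and U = UNIV
        and D = "\<lambda>v. act (Pcoeffs y y) v + 2 *\<^sub>R act (Pcoeffs y v) y - v"])
        (auto intro!: derivative_eq_intros has_derivative_cubic simp: M_minusD)
    ultimately show "v \<in> tangent_M y" by (simp add: tangent_M_def algebra_simps)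
  qed
qed (rule tangent_M_subset[OF y])

text \<open>Normal vectors are found by testing against two kinds of tangent vectors: those in
  E_+(P) orthogonal to y, which force P v = - v, and the vectors Q y with Q orthogonal to P.\<close>

lemma normal_space_M_minus:
  assumes y: "y \<in> M_minus m P"
  shows "normal_space_at (sphere 0 1) (M_minus m P) y = normal_M y"
proof -
  define c where "c = Pcoeffs y y"
  have c: "norm y = 1" "y \<bullet> y = 1" "ip c c = 1" "act c y = y" using M_minusD[OF y] by (simp_all add: c_def)
  have "v \<in> normal_M y \<longleftrightarrow> y \<bullet> v = 0 \<and> (\<forall>w\<in>tangent_M y. orthogonal v w)" for v
  proof (intro iffI conjI ballI)
    assume v: "v \<in> normal_M y"
    then have cv: "act c v = - v" and dv: "\<And>d. act d y \<bullet> v = 0" by (auto simp: normal_M_def c_def)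
    from dv[of c] show "y \<bullet> v = 0" using c by simp
    fix w assume w: "w \<in> tangent_M y"
    then have "v \<bullet> (w - act c w) = 2 * (v \<bullet> act (Pcoeffs y w) y)"
      by (simp add: tangent_M_def c_def)
    moreover have "v \<bullet> act c w = - (v \<bullet> w)" using cv act_inner[of c v w] by simp
    ultimately show "orthogonal v w" using dv[of "Pcoeffs y w"]
      by (simp add: orthogonal_def inner_diff_right inner_commute)
  next
    assume v: "y \<bullet> v = 0 \<and> (\<forall>w\<in>tangent_M y. orthogonal v w)"
    have yv: "y \<bullet> v = 0" using v by simp
    \<comment> \<open>Such w is tangent: <Q w, y> = <Q P w, y> = - <P Q w, y> = - <Q w, y>, the
      correction being a multiple of <w, y> = 0.\<close>
    have tang: "v \<bullet> w = 0" if "act c w = w" "y \<bullet> w = 0" for w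
    proof -
      have "act d w \<bullet> y = 0" for d
      proof -
        have "act d w \<bullet> y = act d (act c w) \<bullet> y" using that by simp
        also have "\<dots> = (2 * ip d c) * (w \<bullet> y) - act c (act d w) \<bullet> y"
          unfolding act_swap[of d c w] by (simp add: inner_diff_left)
        also have "\<dots> = - (act c (act d w) \<bullet> y)" using that by (simp add: inner_commute)
        also have "\<dots> = - (act d w \<bullet> y)" using act_inner[of c "act d w" y] c by simp
        finally show ?thesis by simp
      qed
      then have "act d y \<bullet> w = 0" for d using act_inner[of d w y] by (simp add: inner_commute)
      then have "ip (Pcoeffs y w) (Pcoeffs y w) = 0"
        by (simp flip: act_inner_Pcoeffs)
      then have "w \<in> tangent_M y" using that by (simp add: tangent_M_def act_eq_0 flip: c_def)
      then show ?thesis using v by (simp add: orthogonal_def)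
    qed
    \<comment> \<open>Twice the E_+(P) part of v is tangent, hence orthogonal to v; as |v + P v|^2 =
      2 <v, v + P v>, it vanishes.\<close>
    have "act c (v + act c v) = v + act c v" by (simp add: act_simps act_act c)
    moreover have "y \<bullet> (v + act c v) = 0" using yv c act_inner[of c y v] by (simp add: inner_add_right)
    ultimately have "v \<bullet> (v + act c v) = 0" by (simp add: tang)
    then have "(v + act c v) \<bullet> (v + act c v) = 0"
      by (simp add: inner_add_left inner_add_right act_inner_act c inner_commute[of "act c v"])
    then have cv: "act c v = - v" by (simp add: eq_neg_iff_add_eq_0 add.commute)
    have "act d y \<bullet> v = 0" for d
    proof -
      \<comment> \<open>Removing the P component of Q makes Q y tangent; the removed part sends y to
        a multiple of y, which is orthogonal to v.\<close>
      define e where "e = (\<lambda>i. d i + (- ip d c) * c i)"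
      have ec: "ip e c = 0" "ip c e = 0"
        unfolding e_def ip_add_left ip_add_right ip_scale_left ip_scale_right
        using c ip_commute[of c d] by simp_all
      have ey: "act c (act e y) = - act e y" using act_swap[of c e y] ec c by simp
      have "act (Pcoeffs y (act e y)) y = act e y"
        using Pcoeffs_act[of _ y e] c by (intro act_cong) simp
      moreover have "y \<bullet> act e y = 0" using act_inner_act[of c y e] ec c by simp
      ultimately have "act e y \<in> tangent_M y"
        using ey by (simp add: tangent_M_def scaleR_2 flip: c_def)
      then have "act e y \<bullet> v = 0" using v by (auto simp: orthogonal_def inner_commute)
      then show ?thesis unfolding e_def act_coeff_add act_coeff_scale using c yv by (simp add: inner_diff_left)
    qed
    with cv show "v \<in> normal_M y" by (simp add: normal_M_def c_def)
  qed
  then show ?thesis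
    by (auto simp: normal_space_at_def tangent_space_sphere[OF c(1)] tangent_space_M_minus[OF y])
qed

end

section \<open>The shape operator\<close>

context clifford begin

text \<open>
  Along \<open>M\<^sub>-\<close> these are the orthogonal projections of \<open>N\<close> to the normal space and of \<open>w\<close> to the tangent
  space: the vectors \<open>P\<^sub>i x\<close> are orthonormal and \<open>x\<close> is in their span. Both are polynomial in \<open>x\<close>.
\<close>

definition normal_field :: "real^'n \<Rightarrow> real^'n \<Rightarrow> real^'n" where
  "normal_field N x = (1/2) *\<^sub>R (N - act (Pcoeffs x x) N) - act (Pcoeffs x N) x + (x \<bullet> N) *\<^sub>R x"

definition tangent_field :: "real^'n \<Rightarrow> real^'n \<Rightarrow> real^'n" where
  "tangent_field w x =
     (1/2) *\<^sub>R (w + act (Pcoeffs x x) w) + act (Pcoeffs x w) x - (2 * (x \<bullet> w)) *\<^sub>R x"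

text \<open>The value <S_N X, w>: the N component of the derivative of
  \<open>tangent_field w\<close> in direction X. The other terms of that derivative are killed by N
  or carry the factor <y, w> = 0.\<close>

definition second_form :: "real^'n \<Rightarrow> real^'n \<Rightarrow> real^'n \<Rightarrow> real^'n \<Rightarrow> real" where
  "second_form y N X w = N \<bullet> act (Pcoeffs y X) w + N \<bullet> act (Pcoeffs y w) X"

lemma smooth_normal_field: "smooth_on_open (normal_field N) UNIV"
proof -
  have lin: "smooth_on_open (\<lambda>x. P i *v x) UNIV" for i
    by (intro smooth_linear) (simp add: matrix_vector_mul_bounded_linear)
  have id: "smooth_on_open (\<lambda>x::real^'n. x) UNIV"
    by (intro smooth_linear bounded_linear_ident)
  show ?thesis
    unfolding normal_field_def[abs_def] act_def Pcoeffs_def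
    by (intro smooth_add smooth_diff smooth_scaleR smooth_inner smooth_sum smooth_const lin id)
qed

text \<open>The first term of the field projects N to E_-(P), the second removes the components
  along all P_i x. As x is a combination of these but lies in E_+(P), its share was removed wrongly
  and is added back.\<close>

lemma normal_field_normal:
  assumes x: "x \<in> M_minus m P"
  shows "normal_field N x \<in> normal_M x"
proof -
  define c where "c = Pcoeffs x x"
  define e where "e = Pcoeffs x N"
  have c: "x \<bullet> x = 1" "ip c c = 1" "act c x = x" using M_minusD[OF x] by (simp_all add: c_def)
  have ce: "ip c e = x \<bullet> N" using act_inner_Pcoeffs[of c x N] c by (simp add: e_def)
  have eq: "normal_field N x = (1/2) *\<^sub>R (N - act c N) - act e x + (x \<bullet> N) *\<^sub>R x"
    by (simp add: normal_field_def c_def e_def)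
  have "act c (act e x) = (x \<bullet> N) *\<^sub>R x + (x \<bullet> N) *\<^sub>R x - act e x"
    using act_swap[of c e x] c ce by (simp flip: scaleR_2)
  then have "act c (normal_field N x) = - normal_field N x"
    unfolding eq by (simp add: act_simps act_act c scaleR_diff_right)
  moreover have "act d x \<bullet> normal_field N x = 0" for d
  proof -
    have "act d x \<bullet> act c N = act c (act d x) \<bullet> N" by (simp add: act_inner)
    also have "\<dots> = 2 * ip c d * (x \<bullet> N) - act d x \<bullet> N"
      unfolding act_swap[of c d x] c by (simp add: inner_diff_left)
    finally have 1: "act d x \<bullet> act c N = 2 * ip c d * (x \<bullet> N) - act d x \<bullet> N" .
    have 2: "act d x \<bullet> N = ip d e" by (simp add: e_def act_inner_Pcoeffs)
    have "act d x \<bullet> x = ip d c" by (simp add: c_def act_inner_Pcoeffs)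
    then show ?thesis unfolding eq using 1 2 c ip_commute[of c d]
      by (simp add: inner_diff_right inner_add_right act_inner_act algebra_simps)
  qed
  ultimately show ?thesis by (simp add: normal_M_def flip: c_def)
qed

lemma normal_M_D:
  assumes "y \<in> M_minus m P" "N \<in> normal_M y"
  shows "act (Pcoeffs y y) N = - N" "act d y \<bullet> N = 0" "y \<bullet> N = 0" "N \<bullet> act d y = 0" "N \<bullet> y = 0"
proof -
  show 1: "act (Pcoeffs y y) N = - N" "act d y \<bullet> N = 0" for d using assms by (auto simp: normal_M_def)
  show "y \<bullet> N = 0" using 1(2)[of "Pcoeffs y y"] M_minusD[OF assms(1)] by simp
  then show "N \<bullet> act d y = 0" "N \<bullet> y = 0" using 1(2)[of d] by (simp_all add: inner_commute)
qed

lemma normal_field_at: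
  assumes y: "y \<in> M_minus m P" and N: "N \<in> normal_M y"
  shows "normal_field N y = N"
proof -
  have "ip (Pcoeffs y N) (Pcoeffs y N) = 0"
    using normal_M_D(2)[OF y N] by (simp flip: act_inner_Pcoeffs)
  then have "act (Pcoeffs y N) y = 0" by (rule act_eq_0)
  then show ?thesis using normal_M_D[OF y N]
    by (simp add: normal_field_def flip: scaleR_2)
qed

lemma normal_extension_normal_field:
  assumes y: "y \<in> M_minus m P" and N: "N \<in> normal_M y"
  shows "normal_extension (sphere 0 1) (M_minus m P) y N (normal_field N)"
  unfolding normal_extension_def
  using normal_field_at[OF assms] smooth_normal_field normal_field_normal normal_space_M_minus
  by (intro conjI exI[of _ UNIV]) auto

text \<open>E_+(P) and the span of the P_i x both contain x, which is not tangent; projecting to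
  both counts it twice, hence the factor 2 in the last term of the field.\<close>

lemma tangent_field_tangent:
  assumes x: "x \<in> M_minus m P"
  shows "tangent_field w x \<in> tangent_M x"
proof -
  define c where "c = Pcoeffs x x"
  define e where "e = Pcoeffs x w"
  define s where "s = x \<bullet> w"
  have c: "x \<bullet> x = 1" "ip c c = 1" "act c x = x" using M_minusD[OF x] by (simp_all add: c_def)
  have ce: "ip c e = s" using act_inner_Pcoeffs[of c x w] c by (simp add: e_def s_def)
  have eq: "tangent_field w x = (1/2) *\<^sub>R (w + act c w) + act e x - (2 * s) *\<^sub>R x"
    by (simp add: tangent_field_def c_def e_def s_def)
  have ece: "act c (act e x) = (2 * s) *\<^sub>R x - act e x"
    using act_swap[of c e x] c ce by simp
  have inner: "act d x \<bullet> tangent_field w x = ip d e - s * ip d c" for d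
  proof -
    have "act d x \<bullet> act c w = act c (act d x) \<bullet> w" by (simp add: act_inner)
    also have "\<dots> = 2 * ip c d * s - act d x \<bullet> w"
      unfolding act_swap[of c d x] c by (simp add: inner_diff_left s_def)
    finally have 1: "act d x \<bullet> act c w = 2 * ip c d * s - act d x \<bullet> w" .
    have 2: "act d x \<bullet> w = ip d e" by (simp add: e_def act_inner_Pcoeffs)
    have "act d x \<bullet> x = ip d c" by (simp add: c_def act_inner_Pcoeffs)
    then show ?thesis unfolding eq using 1 2 c ip_commute[of c d]
      by (simp add: inner_diff_right inner_add_right act_inner_act algebra_simps)
  qed
  have "x \<bullet> tangent_field w x = 0" using inner[of c] c ce by simp
  moreover have "act (Pcoeffs x (tangent_field w x)) x = act (\<lambda>i. e i + (- s) * c i) x"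
  proof (rule act_cong)
    fix i assume "i \<le> m"
    then have "ip (\<lambda>j. if j = i then 1 else 0) f = f i" for f
      using sum_coordinate_scaleR[of "{..m}" i f] by (simp add: ip_def)
    then show "Pcoeffs x (tangent_field w x) i = e i + (- s) * c i"
      using inner[of "\<lambda>j. if j = i then 1 else 0"] \<open>i \<le> m\<close> by (simp add: P_eq_act Pcoeffs_def[of x "tangent_field w x"])
  qed
  then have "act (Pcoeffs x (tangent_field w x)) x = act e x - s *\<^sub>R x"
    unfolding act_coeff_add act_coeff_scale by (simp add: c)
  moreover have "act c (tangent_field w x) = (1/2) *\<^sub>R (w + act c w) - act e x"
    unfolding eq by (simp add: act_simps act_act c ece algebra_simps)
  ultimately show ?thesis
    by (simp add: tangent_M_def flip: c_def) (simp add: eq algebra_simps scaleR_2)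
qed

lemma tangent_field_at:
  assumes w: "w \<in> tangent_M y"
  shows "tangent_field w y = w"
proof -
  have "act (Pcoeffs y w) y = (1/2) *\<^sub>R (2 *\<^sub>R act (Pcoeffs y w) y)" by simp
  also have "\<dots> = (1/2) *\<^sub>R (w - act (Pcoeffs y y) w)" using w by (simp add: tangent_M_def)
  finally have "tangent_field w y
      = (1/2) *\<^sub>R (w + act (Pcoeffs y y) w) + (1/2) *\<^sub>R (w - act (Pcoeffs y y) w)"
    using w by (simp add: tangent_field_def tangent_M_def)
  also have "\<dots> = (1/2) *\<^sub>R (2 *\<^sub>R w)" by (simp flip: scaleR_add_right add: scaleR_2)
  finally show ?thesis by simp
qed

lemma has_derivative_tangent_field:
  "(tangent_field w has_derivative (\<lambda>v. act (Pcoeffs y v) w + (act (Pcoeffs v w) y + act (Pcoeffs y w) v)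
     - 2 *\<^sub>R ((v \<bullet> w) *\<^sub>R y + (y \<bullet> w) *\<^sub>R v))) (at y)"
proof -
  have "((\<lambda>x. act (Pcoeffs x w) x) has_derivative
      (\<lambda>v. act (Pcoeffs v w) y + act (Pcoeffs y w) v)) (at y)"
    unfolding act_def Pcoeffs_def
    by (auto intro!: derivative_eq_intros bounded_linear_imp_has_derivative
        simp: sum.distrib add.commute)
  then show ?thesis
    unfolding tangent_field_def[abs_def]
    by (auto intro!: derivative_eq_intros has_derivative_act_Pcoeffs simp: algebra_simps)
qed

text \<open>Differentiate \<open>\<langle>\<eta>, W\<rangle> = 0\<close> along \<open>M\<^sub>-\<close>, where \<open>W\<close> is the tangent field \<open>tangent_field w\<close>.\<close>

lemma weingarten:
  assumes y: "y \<in> M_minus m P" and N: "N \<in> normal_M y"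
    and ext: "normal_extension (sphere 0 1) (M_minus m P) y N \<eta>"
    and X: "X \<in> tangent_M y" and w: "w \<in> tangent_M y"
  shows "frechet_derivative \<eta> (at y) X \<bullet> w = - second_form y N X w"
proof -
  from ext obtain U where U: "y \<in> U" "smooth_on_open \<eta> U"
    and normal: "\<And>x. x \<in> U \<inter> M_minus m P \<Longrightarrow> \<eta> x \<in> normal_M x" and \<eta>y: "\<eta> y = N"
    unfolding normal_extension_def using normal_space_M_minus by blast
  define D where "D X = N \<bullet> (act (Pcoeffs y X) w + (act (Pcoeffs X w) y + act (Pcoeffs y w) X)
     - 2 *\<^sub>R ((X \<bullet> w) *\<^sub>R y + (y \<bullet> w) *\<^sub>R X)) + frechet_derivative \<eta> (at y) X \<bullet> w" for X
  have "D X = 0"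
  proof (rule tangent_space_annihilator[where f = "\<lambda>x. \<eta> x \<bullet> tangent_field w x" and U = U])
    show "X \<in> tangent_space (M_minus m P) y" using X tangent_space_M_minus[OF y] by simp
    show "open U" using U by (simp add: smooth_on_open_def)
    show "\<eta> x \<bullet> tangent_field w x = 0" if "x \<in> U \<inter> M_minus m P" for x
    proof -
      have x: "x \<in> M_minus m P" using that by simp
      have "\<eta> x \<in> normal_space_at (sphere 0 1) (M_minus m P) x"
        using normal[OF that] normal_space_M_minus[OF x] by simp
      moreover have "tangent_field w x \<in> tangent_space (M_minus m P) x"
        using tangent_field_tangent[OF x] tangent_space_M_minus[OF x] by simp
      ultimately show ?thesis by (simp add: normal_space_at_def orthogonal_def)
    qed
    show "((\<lambda>x. \<eta> x \<bullet> tangent_field w x) has_derivative D) (at y)"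
      using has_derivative_inner[OF smooth_on_open_has_derivative[OF U(2,1)] has_derivative_tangent_field[of w y]]
      by (simp add: \<eta>y tangent_field_at[OF w] D_def[abs_def])
  qed (rule U)
  moreover have "y \<bullet> w = 0" using w by (simp add: tangent_M_def)
  ultimately show ?thesis using normal_M_D[OF y N]
    by (simp add: D_def second_form_def inner_add_right inner_diff_right)
qed

text \<open>The description is proper: \<open>normal_field\<close> provides an extension, and by
  \<open>weingarten\<close> the inner products with tangent vectors do not depend on it. Projecting
  to the tangent space of the sphere preserves them, since that space contains
  \<open>tangent_M y\<close>.\<close>

lemma shape_operator_M_minus:
  assumes y: "y \<in> M_minus m P" and N: "N \<in> normal_M y" and X: "X \<in> tangent_M y"
  defines "Z \<equiv> shape_operator (sphere 0 1) (M_minus m P) y N X"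
  shows "Z \<in> tangent_M y" "w \<in> tangent_M y \<Longrightarrow> Z \<bullet> w = second_form y N X w"
proof -
  let ?Z = "\<lambda>\<eta>. - orthogonal_projection (tangent_space (M_minus m P) y)
      (covariant_derivative (sphere 0 1) y X \<eta>)"
  have y1: "norm y = 1" using M_minusD[OF y] by simp
  have inT: "?Z \<eta> \<in> tangent_M y" for \<eta>
    using orthogonal_projection(1)[OF subspace_tangent_M, of y] subspace_neg[OF subspace_tangent_M]
    by (simp add: tangent_space_M_minus[OF y])
  have inner: "?Z \<eta> \<bullet> w = second_form y N X w"
    if "normal_extension (sphere 0 1) (M_minus m P) y N \<eta>" "w \<in> tangent_M y" for \<eta> w
  proof -
    have "w \<in> {v. y \<bullet> v = 0}" using that(2) by (simp add: tangent_M_def)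
    then show ?thesis
      using weingarten[OF y N that(1) X that(2)]
      by (simp add: tangent_space_M_minus[OF y] orthogonal_projection(2)[OF subspace_tangent_M that(2)]
        covariant_derivative_def tangent_space_sphere[OF y1] orthogonal_projection(2)[OF subspace_hyperplane])
  qed
  note ext = normal_extension_normal_field[OF y N]
  have "Z = ?Z (normal_field N)"
    unfolding Z_def shape_operator_def
  proof (rule the_equality)
    fix Z assume "\<exists>\<eta>. normal_extension (sphere 0 1) (M_minus m P) y N \<eta> \<and> Z = ?Z \<eta>"
    then obtain \<eta> where \<eta>: "normal_extension (sphere 0 1) (M_minus m P) y N \<eta>" "Z = ?Z \<eta>" by blast
    define D where "D = ?Z \<eta> - ?Z (normal_field N)"
    have "D \<in> tangent_M y"
      unfolding D_def by (intro subspace_diff[OF subspace_tangent_M] inT)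
    then have "?Z \<eta> \<bullet> D = ?Z (normal_field N) \<bullet> D"
      using inner[OF \<eta>(1)] inner[OF ext] by metis
    then have "D \<bullet> D = 0" unfolding D_def inner_diff_left by linarith
    then show "Z = ?Z (normal_field N)" using \<eta>(2) by (simp add: D_def)
  qed (use ext in blast)
  then show "Z \<in> tangent_M y" "w \<in> tangent_M y \<Longrightarrow> Z \<bullet> w = second_form y N X w"
    using inT inner[OF ext] by simp_all
qed

text \<open>With Q the combination of coefficients \<open>d\<close>, <Q y, w> = <Q y, P w> = <P Q y,
  w> = - <Q y, w>, the correction being a multiple of <y, w> = 0. By the choice of \<open>d\<close>
  the left side is |d|^2.\<close>

lemma Pcoeffs_eq_0_of_fixed:
  assumes y: "y \<in> M_minus m P" and "act (Pcoeffs y y) w = w" "y \<bullet> w = 0" "i \<le> m"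
  shows "Pcoeffs y w i = 0"
proof -
  define c where "c = Pcoeffs y y"
  define d where "d = Pcoeffs y w"
  have c: "act c y = y" "act c w = w" using M_minusD[OF y] assms by (simp_all add: c_def)
  have "act d y \<bullet> w = act d y \<bullet> act c w" using c by simp
  also have "\<dots> = act c (act d y) \<bullet> w" by (simp add: act_inner)
  also have "\<dots> = - (act d y \<bullet> w)"
    unfolding act_swap[of c d y] c using assms by (simp add: inner_diff_left)
  finally have "ip d d = 0" by (simp add: d_def act_inner_Pcoeffs)
  then show ?thesis using ip_self_eq_0 assms by (simp add: d_def)
qed

lemma fixed_in_tangent_M:
  assumes y: "y \<in> M_minus m P" and "act (Pcoeffs y y) w = w" "y \<bullet> w = 0"
  shows "w \<in> tangent_M y" "act (Pcoeffs y w) x = 0"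
proof -
  show "act (Pcoeffs y w) x = 0" for x
    using Pcoeffs_eq_0_of_fixed[OF assms] by (simp add: act_def)
  then show "w \<in> tangent_M y" using assms by (simp add: tangent_M_def)
qed

text \<open>The shape operator has tangent values, so its vanishing can be tested against tangent w.
  For X in E_+(P) orthogonal to y the form reduces to <N, Q X> with Q given by
  \<open>Pcoeffs y w\<close>; the converse uses two kinds of test vectors.\<close>

lemma shape_kernel_M_minus:
  assumes y: "y \<in> M_minus m P" and N: "N \<in> normal_M y" "N \<noteq> 0"
  shows "X \<in> shape_kernel (sphere 0 1) (M_minus m P) y N \<longleftrightarrow>
     act (Pcoeffs y y) X = X \<and> y \<bullet> X = 0 \<and> (\<forall>d. act d X \<bullet> N = 0)"
proof -
  define c where "c = Pcoeffs y y"
  have c: "y \<bullet> y = 1" "ip c c = 1" "act c y = y" using M_minusD[OF y] by (simp_all add: c_def)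
  have cN: "act c N = - N" using normal_M_D[OF y N(1)] by (simp add: c_def)
  have "X \<in> shape_kernel (sphere 0 1) (M_minus m P) y N \<longleftrightarrow>
    X \<in> tangent_M y \<and> (\<forall>w\<in>tangent_M y. second_form y N X w = 0)"
  proof (cases "X \<in> tangent_M y")
    case True
    let ?Z = "shape_operator (sphere 0 1) (M_minus m P) y N X"
    have "?Z = 0 \<longleftrightarrow> (\<forall>w\<in>tangent_M y. ?Z \<bullet> w = 0)"
      using shape_operator_M_minus(1)[OF y N(1) True] by (metis inner_eq_zero_iff inner_zero_left)
    then show ?thesis
      using True shape_operator_M_minus(2)[OF y N(1) True]
      by (simp add: shape_kernel_def tangent_space_M_minus[OF y])
  qed (simp add: shape_kernel_def tangent_space_M_minus[OF y])
  also have "\<dots> \<longleftrightarrow> act c X = X \<and> y \<bullet> X = 0 \<and> (\<forall>d. act d X \<bullet> N = 0)"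
  proof (intro iffI conjI)
    assume X: "act c X = X \<and> y \<bullet> X = 0 \<and> (\<forall>d. act d X \<bullet> N = 0)"
    then show "X \<in> tangent_M y" "\<forall>w\<in>tangent_M y. second_form y N X w = 0"
      using fixed_in_tangent_M[OF y, of X] by (auto simp: second_form_def c_def inner_commute)
  next
    assume *: "X \<in> tangent_M y \<and> (\<forall>w\<in>tangent_M y. second_form y N X w = 0)"
    then show yX: "y \<bullet> X = 0" by (simp add: tangent_M_def)
    define d where "d = Pcoeffs y X"
    have cd: "ip c d = 0" using act_inner_Pcoeffs[of c y X] c yX by (simp add: d_def)
    \<comment> \<open>With X = u + Q y and u in E_+(P), the test vector Q N lies in E_+(P). Pairing
      with it yields <N, Q Q N> = |Q|^2 |N|^2, so Q = 0 because N is nonzero.\<close>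
    have cdN: "act c (act d N) = act d N"
      using act_swap[of c d N] cd cN by (simp add: act_simps)
    have ydN: "y \<bullet> act d N = 0" using normal_M_D[OF y N(1)] act_inner[of d y N] by simp
    have "second_form y N X (act d N) = 0"
      using * fixed_in_tangent_M(1)[OF y, of "act d N"] cdN ydN by (simp add: c_def)
    then have "N \<bullet> act d (act d N) = 0"
      using fixed_in_tangent_M(2)[OF y, of "act d N"] cdN ydN by (simp add: second_form_def c_def d_def)
    then have dd: "ip d d = 0" using N by (simp add: act_act)
    then show cX: "act c X = X"
      using * act_eq_0[OF dd, of y] by (simp add: tangent_M_def d_def c_def)
    show "\<forall>d. act d X \<bullet> N = 0"
    proof
      fix d
      \<comment> \<open>Test vectors Q y with Q orthogonal to P give <Q X, N> = 0; the component
        along P contributes <X, N>, which vanishes between opposite eigenspaces.\<close>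
      define e where "e = (\<lambda>i. d i + (- ip d c) * c i)"
      have ec: "ip c e = 0"
        unfolding e_def ip_add_right ip_scale_right
        using c ip_commute[of c d] by simp
      have ey: "act c (act e y) = - act e y" using act_swap[of c e y] ec c by simp
      have e: "act (Pcoeffs y (act e y)) x = act e x" for x
        using Pcoeffs_act[of _ y e] c by (intro act_cong) simp
      moreover have "y \<bullet> act e y = 0" using act_inner_act[of c y e] ec c by simp
      ultimately have "act e y \<in> tangent_M y"
        using ey by (simp add: tangent_M_def scaleR_2 flip: c_def)
      then have "second_form y N X (act e y) = 0" using * by blast
      then have "N \<bullet> act e X = 0"
        using act_eq_0[OF dd] e by (simp add: second_form_def d_def)
      moreover have "N \<bullet> X = 0"
      proof -
        have "N \<bullet> X = act c N \<bullet> X" using cX act_inner[of c N X] by simp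
        then show ?thesis using cN by simp
      qed
      ultimately show "act d X \<bullet> N = 0"
        unfolding e_def act_coeff_add act_coeff_scale using cX
        by (simp add: inner_diff_left inner_diff_right inner_commute)
    qed
  qed
  finally show ?thesis by (simp add: c_def)
qed

end

section \<open>Eigenspaces and kernels of the shape operator\<close>

text \<open>For x nonzero, x and J x are orthogonal and span a plane; since J is skew, the
  complement of this plane in E is again invariant. Induct on the dimension.\<close>

lemma even_dim_complex_structure:
  fixes E :: "'a::euclidean_space set"
  assumes J: "linear J" "\<And>x. J (J x) = - x" "\<And>x z. x \<bullet> J z = - (J x \<bullet> z)"
    and E: "subspace E" "\<And>x. x \<in> E \<Longrightarrow> J x \<in> E"
  shows "even (dim E)"
  using E
proof (induction "dim E" arbitrary: E rule: less_induct)
  case less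
  show ?case
  proof (cases "E \<subseteq> {0}")
    case True
    then show ?thesis by (metis dim_eq_0 even_zero)
  next
    case False
    then obtain x where x: "x \<in> E" "x \<noteq> 0" by blast
    have Jx: "J x \<noteq> 0" using J(2)[of x] x(2) linear_0[OF J(1)] by auto
    have xJx: "x \<bullet> J x = 0" using J(3)[of x x] by (simp add: inner_commute)
    have "x \<noteq> J x" using xJx x by auto
    then have "dim {x, J x} = 2"
      using pairwise_orthogonal_independent[of "{x, J x}"] xJx x Jx
      by (simp add: dim_eq_card_independent pairwise_insert orthogonal_def inner_commute)
    define F where "F = {z \<in> E. \<forall>w \<in> span {x, J x}. orthogonal w z}"
    have F_iff: "z \<in> F \<longleftrightarrow> z \<in> E \<and> x \<bullet> z = 0 \<and> J x \<bullet> z = 0" for z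
    proof -
      have "(\<forall>w \<in> span {x, J x}. orthogonal w z) \<longleftrightarrow> (\<forall>w \<in> {x, J x}. orthogonal w z)"
        using orthogonal_to_span[of _ "{x, J x}" z] span_base[of _ "{x, J x}"]
        by (metis orthogonal_commute)
      then show ?thesis by (auto simp: F_def orthogonal_def)
    qed
    have "dim F + dim (span {x, J x}) = dim E"
      unfolding F_def using x less.prems
      by (intro dim_subspace_orthogonal_to_vectors subspace_span span_minimal) auto
    with \<open>dim {x, J x} = 2\<close> have dimF: "dim E = dim F + 2" by simp
    have "subspace F"
      using less.prems(1) by (auto simp: subspace_def F_iff inner_add_right)
    moreover have "J z \<in> F" if "z \<in> F" for z
    proof -
      have "J x \<bullet> J z = - (J (J x) \<bullet> z)" by (rule J(3))
      then show ?thesis using that less.prems(2) J(3)[of x z] by (simp add: F_iff J(2))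
    qed
    ultimately have "even (dim F)" using dimF by (intro less.hyps) auto
    with dimF show ?thesis by simp
  qed
qed

text \<open>Write 2x = p + q with p fixed and q negated by B. Then \<open>q + A *v q\<close> is
  fixed by A, hence by B, hence orthogonal to q, which forces A q = - q.\<close>

lemma symmetric_involution_eqI:
  fixes A B :: "real^'n^'n"
  assumes "transpose A = A" "A ** A = mat 1" "transpose B = B" "B ** B = mat 1"
    and "E_plus A = E_plus B"
  shows "A = B"
proof -
  have A: "A *v (A *v z) = z" "(A *v z) \<bullet> w = z \<bullet> (A *v w)"
    and B: "B *v (B *v z) = z" "(B *v z) \<bullet> w = z \<bullet> (B *v w)" for z w
    using assms by (metis matrix_vector_mul_assoc matrix_vector_mul_lid
        dot_lmul_matrix vector_transpose_matrix)+
  have fixed: "A *v z = z \<longleftrightarrow> B *v z = z" for z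
    using assms(5) by (auto simp: E_plus_def set_eq_iff)
  have "A *v x = B *v x" for x
  proof -
    let ?p = "x + B *v x"
    define q where "q = x - B *v x"
    have p: "A *v ?p = ?p" unfolding fixed by (simp add: matrix_vector_right_distrib B add.commute)
    have "A *v (q + A *v q) = q + A *v q"
      by (simp add: matrix_vector_right_distrib A add.commute)
    then have "B *v (q + A *v q) = q + A *v q" by (simp add: fixed)
    moreover have "B *v q = - q" by (simp add: q_def matrix_vector_mult_diff_distrib B)
    ultimately have "q \<bullet> (q + A *v q) = 0" using B(2)[of q "q + A *v q"] by simp
    then have "(q + A *v q) \<bullet> (q + A *v q) = 0"
      by (simp add: inner_add_left inner_add_right A)
    then have Aq: "A *v q = - q" by (simp add: eq_neg_iff_add_eq_0 add.commute)
    have "?p + q = 2 *\<^sub>R x" unfolding q_def scaleR_2 by simp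
    then have "2 *\<^sub>R (A *v x) = A *v (?p + q)"
      by (metis matrix_vector_mult_scaleR)
    also have "\<dots> = 2 *\<^sub>R (B *v x)"
      unfolding matrix_vector_right_distrib[of A ?p q] p Aq by (simp add: q_def scaleR_2)
    finally show ?thesis by simp
  qed
  then show ?thesis by (simp add: matrix_eq)
qed

context clifford begin

section \<open>The Clifford sphere in coefficients and the eigenspaces of its elements\<close>

lemma comb_comb_trace: "trace (comb c ** comb d) = ip c d * real CARD('n)"
proof -
  have "comb c ** comb d + comb d ** comb c = (2 * ip c d) *\<^sub>R mat 1"
    by (simp add: matrix_eq matrix_vector_mult_add_rdistrib matrix_vector_mul_assoc[symmetric]
        comb_mult_vec act_anticommute scaleR_matrix_vector_assoc[symmetric])
  then have "trace (comb c ** comb d + comb d ** comb c) = trace ((2 * ip c d) *\<^sub>R (mat 1 :: real^'n^'n))"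
    by simp
  moreover have "trace ((2 * ip c d) *\<^sub>R (mat 1 :: real^'n^'n)) = 2 * ip c d * real CARD('n)"
    by (simp add: trace_def mat_def)
  ultimately show ?thesis by (simp add: trace_add trace_mul_sym[of "comb d"])
qed

lemma endo_inner_comb: "endo_inner (comb c) (comb d) = ip c d"
  by (simp add: endo_inner_def comb_comb_trace)

lemma comb_coeff_add: "comb (\<lambda>i. c i + d i) = comb c + comb d"
  by (simp add: comb_def scaleR_add_left sum.distrib)

lemma comb_coeff_scale: "comb (\<lambda>i. r * c i) = r *\<^sub>R comb c"
  by (simp add: comb_def scaleR_sum_right)

lemma P_eq_comb: "i \<le> m \<Longrightarrow> P i = comb (\<lambda>j. if j = i then 1 else 0)"
  by (simp add: comb_def sum_coordinate_scaleR)

lemma clifford_span_eq: "clifford_span m P = range comb"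
proof
  have "subspace (range comb)"
  proof (rule subspaceI)
    have "comb (\<lambda>i. 0) = 0" by (simp add: comb_def)
    then show "0 \<in> range comb" by (metis rangeI)
  qed (auto simp flip: comb_coeff_add comb_coeff_scale)
  then show "clifford_span m P \<subseteq> range comb"
    unfolding clifford_span_def by (intro span_minimal) (auto simp: P_eq_comb)
  show "range comb \<subseteq> clifford_span m P"
    unfolding clifford_span_def comb_def by (auto intro!: span_sum intro: span_scale span_base)
qed

lemma clifford_sphere_eq: "clifford_sphere m P = {comb c |c. ip c c = 1}"
  by (auto simp: clifford_sphere_def clifford_span_eq endo_inner_comb)

lemma E_plus_comb: "E_plus (comb c) = {x. act c x = x}"
  by (simp add: E_plus_def comb_mult_vec)

lemma M_minus_iff_E_plus:
  "y \<in> M_minus m P \<longleftrightarrow> norm y = 1 \<and> (\<exists>A\<in>clifford_sphere m P. y \<in> E_plus A)"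
proof
  assume "y \<in> M_minus m P"
  from M_minusD[OF this] show "norm y = 1 \<and> (\<exists>A\<in>clifford_sphere m P. y \<in> E_plus A)"
    by (auto simp: clifford_sphere_eq E_plus_comb intro!: bexI[of _ "comb (Pcoeffs y y)"])
qed (auto simp: clifford_sphere_eq E_plus_comb intro: M_minusI)

lemma E_plus_eq_fixed:
  assumes "A \<in> clifford_sphere m P" "y \<in> E_plus A" "norm y = 1"
  shows "E_plus A = {x. act (Pcoeffs y y) x = x}"
proof -
  obtain c where c: "A = comb c" "ip c c = 1" using assms by (auto simp: clifford_sphere_eq)
  then have "Pcoeffs y y i = c i" if "i \<le> m" for i
    using assms that by (intro Pcoeffs_eq_of_act_eq) (auto simp: E_plus_comb)
  then show ?thesis using act_cong[of "Pcoeffs y y" c] by (simp add: c E_plus_comb)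
qed

lemma clifford_sphere_involution:
  assumes "A \<in> clifford_sphere m P"
  shows "transpose A = A" "A ** A = mat 1"
proof -
  obtain c where c: "A = comb c" "ip c c = 1" using assms by (auto simp: clifford_sphere_eq)
  show "A ** A = mat 1"
    by (simp add: matrix_eq matrix_vector_mul_assoc[symmetric] c comb_mult_vec act_act)
  have "(transpose A *v x) \<bullet> y = (A *v x) \<bullet> y" for x y
    by (simp only: transpose_matrix_vector dot_lmul_matrix c comb_mult_vec act_inner)
  then have "transpose A *v x = A *v x" for x by (metis vector_eq_rdot)
  then show "transpose A = A" by (simp add: matrix_eq)
qed

lemma obtain_orthogonal_coeffs:
  obtains d where "ip c d = 0" "ip d d = 1"
proof -
  obtain d where d: "ip c d = 0" "ip d d > 0"
  proof (cases "c 0 = 0")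
    case True
    let ?d = "\<lambda>i. if i = 0 then 1 else 0"
    have "ip c ?d = c 0" "ip ?d ?d = 1"
      by (simp_all add: ip_def if_distrib cong: if_cong)
    with True that show ?thesis by simp
  next
    case False
    \<comment> \<open>The quarter turn of \<open>(c 0, c 1)\<close> in the first two coordinates,
      both of which are present because m >= 1.\<close>
    let ?d = "\<lambda>i. if i = 0 then c 1 else if i = 1 then - c 0 else 0"
    have "{..m} = insert 0 (insert 1 {2..m})" using m_ge_1 by auto
    then have "ip c ?d = 0" "ip ?d ?d = (c 0)\<^sup>2 + (c 1)\<^sup>2"
      by (simp_all add: ip_def power2_eq_square)
    with False that show ?thesis by (simp add: sum_power2_gt_zero_iff)
  qed
  show thesis
  proof (rule that)
    show "ip c (\<lambda>i. (1 / sqrt (ip d d)) * d i) = 0" using d by (simp only: ip_scale_right)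
    show "ip (\<lambda>i. (1 / sqrt (ip d d)) * d i) (\<lambda>i. (1 / sqrt (ip d d)) * d i) = 1"
      unfolding ip_scale_left ip_scale_right using d by simp
  qed
qed

text \<open>An element Q of the sphere orthogonal to P anticommutes with P, so it maps the
  r-eigenspace injectively into the (-r)-eigenspace. Taking r = 1 and r = -1 gives equal
  dimensions.\<close>

lemma dim_fixed_le:
  assumes "ip c c = 1"
  shows "dim {x. act c x = r *\<^sub>R x} \<le> dim {x. act c x = - (r *\<^sub>R x)}"
proof -
  obtain d where d: "ip c d = 0" "ip d d = 1" by (rule obtain_orthogonal_coeffs)
  have "inj (act d)"
    by (rule inj_on_inverseI[of _ "act d"]) (simp add: act_act d)
  then have eq: "dim (act d ` {x. act c x = r *\<^sub>R x}) = dim {x. act c x = r *\<^sub>R x}"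
    by (intro dim_image_eq linear_act) (auto intro: inj_on_subset)
  have "act d ` {x. act c x = r *\<^sub>R x} \<subseteq> {x. act c x = - (r *\<^sub>R x)}"
    using act_swap[of c d] d by (auto simp: act_simps)
  from dim_subset[OF this] show ?thesis unfolding eq .
qed

lemma subspace_eigen: "subspace {x. act c x = r *\<^sub>R x}"
proof (rule subspaceI)
  fix x assume "x \<in> {x. act c x = r *\<^sub>R x}"
  then show "k *\<^sub>R x \<in> {x. act c x = r *\<^sub>R x}" for k
    by (simp add: act_simps mult.commute)
qed (simp_all add: act_simps scaleR_add_right)

lemma dim_fixed:
  assumes c: "ip c c = 1"
  shows "2 * dim {x. act c x = x} = CARD('n)"
proof -
  let ?p = "{x. act c x = 1 *\<^sub>R x}" and ?q = "{x. act c x = (-1) *\<^sub>R x}"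
  have "z = 0" if "z \<in> ?p \<inter> ?q" for z
  proof -
    from that have "act c z = z" "act c z = - z" by auto
    then have "z \<bullet> z = - (z \<bullet> z)" by (metis inner_minus_left)
    then show ?thesis by simp
  qed
  then have "?p \<inter> ?q = {0}" by (auto simp: act_simps)
  moreover have "{x + y |x y. x \<in> ?p \<and> y \<in> ?q} = UNIV"
  proof -
    have "z = (1/2) *\<^sub>R (z + act c z) + (1/2) *\<^sub>R (z - act c z)" for z
    proof -
      have "(1/2) *\<^sub>R (z + act c z) + (1/2) *\<^sub>R (z - act c z) = (1/2) *\<^sub>R (2 *\<^sub>R z)"
        unfolding scaleR_2 scaleR_add_right[symmetric] by simp
      then show ?thesis by simp
    qed
    moreover have "(1/2) *\<^sub>R (z + act c z) \<in> ?p" "(1/2) *\<^sub>R (z - act c z) \<in> ?q" for z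
      by (simp_all add: act_simps act_act c algebra_simps)
    ultimately show ?thesis by blast
  qed
  ultimately have "CARD('n) = dim ?p + dim ?q"
    using dim_sums_Int[OF subspace_eigen[of c 1] subspace_eigen[of c "-1"]] by simp
  moreover have "dim ?p = dim ?q"
    using dim_fixed_le[OF c, of 1] dim_fixed_le[OF c, of "-1"] by simp
  ultimately show ?thesis by simp
qed

text \<open>By hypothesis the sum of E_+(P) and W has dimension less than 2l, so a nonzero vector is
  orthogonal to both; being orthogonal to E_+(P), it lies in E_-(P). The bound is doubled to avoid
  halving \<open>CARD('n)\<close>.\<close>

lemma anti_fixed_exists:
  assumes c: "ip c c = 1" and W: "subspace W"
    and dim: "2 * dim W < CARD('n) + 2 * dim ({x. act c x = x} \<inter> W)"
  obtains v where "norm v = 1" "act c v = - v" "\<And>w. w \<in> W \<Longrightarrow> w \<bullet> v = 0"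
proof -
  let ?E = "{x. act c x = x}"
  define S where "S = {x + y |x y. x \<in> ?E \<and> y \<in> W}"
  have E: "subspace ?E" using subspace_eigen[of c 1] by simp
  have "dim S + dim (?E \<inter> W) = dim ?E + dim W"
    unfolding S_def by (rule dim_sums_Int[OF E W])
  moreover have "DIM(real^'n) = CARD('n)" by simp
  ultimately have "dim S < DIM(real^'n)" using dim dim_fixed[OF c] by linarith
  then have "\<exists>x. x \<noteq> 0 \<and> (\<forall>y\<in>span S. orthogonal x y)"
    by (rule orthogonal_to_subspace_exists) auto
  then obtain x where x: "x \<noteq> 0" "\<And>y. y \<in> span S \<Longrightarrow> orthogonal x y"
    by auto
  have xE: "x \<bullet> y = 0" if "y \<in> ?E" for y
  proof -
    have "y = y + 0" by simp
    then have "y \<in> S" using that subspace_0[OF W] unfolding S_def by blast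
    then show ?thesis using x(2)[OF span_base] by (simp only: orthogonal_def)
  qed
  have xW: "w \<bullet> x = 0" if "w \<in> W" for w
  proof -
    have "w = 0 + w" by simp
    then have "w \<in> S" using that subspace_0[OF E] unfolding S_def by blast
    then show ?thesis using x(2)[OF span_base] by (simp only: orthogonal_def inner_commute)
  qed
  have "x \<bullet> (x + act c x) = 0"
    by (rule xE) (simp add: act_simps act_act c)
  then have "(x + act c x) \<bullet> (x + act c x) = 0"
    by (simp add: inner_add_left inner_add_right act_inner_act c inner_commute[of "act c x"])
  then have "act c x = - x" by (simp add: eq_neg_iff_add_eq_0 add.commute)
  with x(1) xW show thesis
    by (intro that[of "(1 / norm x) *\<^sub>R x"]) (simp_all add: act_simps)
qed

text \<open>Counting dimensions, some normal \<open>N\<close> is orthogonal to all \<open>Q u\<close>; then \<open>u\<close> lies in \<open>ker S\<^sub>N\<close>.\<close>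

lemma fixed_in_shape_kernel:
  assumes y: "y \<in> M_minus m P" and u: "act (Pcoeffs y y) u = u" "y \<bullet> u = 0" "u \<noteq> 0"
    and dim: "4 * m + 2 \<le> CARD('n)"
  shows "\<exists>N\<in>normal_M y - {0}. u \<in> shape_kernel (sphere 0 1) (M_minus m P) y N"
proof -
  define c where "c = Pcoeffs y y"
  have c: "y \<bullet> y = 1" "ip c c = 1" "act c y = y" "act c u = u"
    using M_minusD[OF y] u by (simp_all add: c_def)
  define S where "S = (\<lambda>i. P i *v y) ` {..m} \<union> (\<lambda>i. P i *v u) ` {..m}"
  have act_S: "act d y \<in> span S" "act d u \<in> span S" for d
    unfolding act_def by (rule span_sum, rule span_scale, rule span_base, simp add: S_def)+
  have "card S \<le> (m + 1) + (m + 1)"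
    unfolding S_def by (intro order.trans[OF card_Un_le] add_mono order.trans[OF card_image_le]) auto
  moreover have "dim (span S) \<le> card S"
    by (rule dim_le_card) (auto simp: S_def)
  \<comment> \<open>P fixes y and u, so both lie in \<open>span S\<close>. This gain is essential:
    4m + 4 < 2l fails in the extreme case l = 2m + 1, but 4m + 4 < 2l + 4 holds.\<close>
  moreover have "2 \<le> dim ({x. act c x = x} \<inter> span S)"
  proof -
    have "y \<noteq> u" using u c by auto
    then have "card {y, u} = 2" by simp
    moreover have "independent {y, u}"
      using u c by (intro pairwise_orthogonal_independent) (auto simp: pairwise_insert orthogonal_def inner_commute)
    moreover have "{y, u} \<subseteq> {x. act c x = x} \<inter> span S"
      using act_S[of c] c by auto
    ultimately show ?thesis using independent_card_le_dim[of "{y, u}"] by simp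
  qed
  ultimately have "2 * dim (span S) < CARD('n) + 2 * dim ({x. act c x = x} \<inter> span S)"
    using dim by linarith
  then have "\<exists>N. norm N = 1 \<and> act c N = - N \<and> (\<forall>w\<in>span S. w \<bullet> N = 0)"
    by (rule anti_fixed_exists[OF c(2) subspace_span]) auto
  then obtain N where N: "norm N = 1" "act c N = - N" "\<And>w. w \<in> span S \<Longrightarrow> w \<bullet> N = 0"
    by auto
  then have "N \<in> normal_M y" "N \<noteq> 0" using act_S by (auto simp: normal_M_def c_def)
  moreover from this have "u \<in> shape_kernel (sphere 0 1) (M_minus m P) y N"
    using shape_kernel_M_minus[OF y] u N act_S by simp
  ultimately show ?thesis by blast
qed

lemma span_shape_kernels:
  assumes y: "y \<in> M_minus m P" and dim: "4 * m + 2 \<le> CARD('n)"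
  shows "span (\<Union>N \<in> normal_space_at (sphere 0 1) (M_minus m P) y - {0}.
           shape_kernel (sphere 0 1) (M_minus m P) y N) = {x. act (Pcoeffs y y) x = x \<and> y \<bullet> x = 0}"
    (is "span ?K = ?V")
proof
  have "subspace ?V"
    by (auto simp: subspace_def act_simps inner_add_right)
  moreover have "?K \<subseteq> ?V"
    using shape_kernel_M_minus[OF y] by (auto simp: normal_space_M_minus[OF y])
  ultimately show "span ?K \<subseteq> ?V" by (rule span_minimal[rotated])
  show "?V \<subseteq> span ?K"
  proof
    fix u assume u: "u \<in> ?V"
    show "u \<in> span ?K"
    proof (cases "u = 0")
      case False
      with u have "u \<in> ?K"
        using fixed_in_shape_kernel[OF y _ _ _ dim, of u] unfolding normal_space_M_minus[OF y] by blast
      then show ?thesis by (rule span_base)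
    qed (simp add: span_zero)
  qed
qed

lemma direct_sum_E_plus:
  assumes A: "A \<in> clifford_sphere m P" "y \<in> E_plus A" "norm y = 1" and dim: "4 * m + 2 \<le> CARD('n)"
  shows "is_direct_sum (E_plus A) (span {y})
          (span (\<Union>N \<in> normal_space_at (sphere 0 1) (M_minus m P) y - {0}.
                   shape_kernel (sphere 0 1) (M_minus m P) y N))"
proof -
  have y: "y \<in> M_minus m P" using A by (auto simp: M_minus_iff_E_plus)
  let ?c = "Pcoeffs y y"
  have c: "y \<bullet> y = 1" "act ?c y = y" using M_minusD[OF y] by simp_all
  let ?V = "{x. act ?c x = x \<and> y \<bullet> x = 0}"
  have V: "subspace ?V"
    by (auto simp: subspace_def act_simps inner_add_right)
  have "{x. act ?c x = x} = {u + w |u w. u \<in> span {y} \<and> w \<in> ?V}"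
  proof (intro set_eqI iffI)
    fix x assume "x \<in> {x. act ?c x = x}"
    then have "x - (y \<bullet> x) *\<^sub>R y \<in> ?V" using c by (simp add: act_simps inner_diff_right)
    moreover have "(y \<bullet> x) *\<^sub>R y \<in> span {y}" by (simp add: span_mul span_base)
    moreover have "x = (y \<bullet> x) *\<^sub>R y + (x - (y \<bullet> x) *\<^sub>R y)" by simp
    ultimately show "x \<in> {u + w |u w. u \<in> span {y} \<and> w \<in> ?V}" by blast
  qed (use c in \<open>auto simp: span_singleton act_simps\<close>)
  moreover have "span {y} \<inter> ?V = {0}"
    using c by (auto simp: span_singleton act_simps)
  ultimately show ?thesis
    unfolding is_direct_sum_def span_shape_kernels[OF y dim] E_plus_eq_fixed[OF A]
    using V by simp
qed

end

section \<open>Focal manifolds of the isoparametric family\<close>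

context clifford begin

text \<open>By polarisation each P_i maps E into its orthogonal complement, and onto it since both
  have dimension l. Hence P_0 P_1 preserves E; it is skew with square -1.\<close>

lemma isotropic_even:
  assumes E: "subspace E" "2 * dim E = CARD('n)"
    and iso: "\<And>x i. x \<in> E \<Longrightarrow> i \<le> m \<Longrightarrow> Pcoeffs x x i = 0"
  shows "even (dim E)"
proof -
  define F where "F = {z. \<forall>x\<in>E. orthogonal x z}"
  have "dim {z \<in> UNIV. \<forall>x\<in>E. orthogonal x z} + dim E = dim (UNIV :: (real^'n) set)"
    by (intro dim_subspace_orthogonal_to_vectors E) auto
  then have dimF: "dim F = dim E" using E(2) by (simp add: F_def)
  have subF: "subspace F"
    unfolding F_def using subspace_orthogonal_to_vectors[of E] by simp
  have P_F: "(\<lambda>x. P i *v x) ` E = F" if i: "i \<le> m" for i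
  proof (rule subspace_dim_equal)
    show "subspace ((\<lambda>x. P i *v x) ` E)" "subspace F"
      using E subF by (auto intro: linear_subspace_image matrix_vector_mul_linear)
    have "inj (\<lambda>x. P i *v x)"
      using P_anticommute[OF i i] by (intro inj_on_inverseI[of _ "\<lambda>x. P i *v x"]) (simp add: scaleR_2[symmetric])
    then have "dim ((\<lambda>x. P i *v x) ` E) = dim E"
      by (intro dim_image_eq matrix_vector_mul_linear) (auto intro: inj_on_subset)
    then show "dim F \<le> dim ((\<lambda>x. P i *v x) ` E)" using dimF by simp
    show "(\<lambda>x. P i *v x) ` E \<subseteq> F"
    proof clarsimp
      fix z assume z: "z \<in> E"
      have "x \<bullet> (P i *v z) = 0" if x: "x \<in> E" for x
      proof -
        have "Pcoeffs (x + z) (x + z) i = Pcoeffs x x i + Pcoeffs z z i + 2 * (x \<bullet> (P i *v z))"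
          using P_inner[OF i, of z x] P_inner[OF i, of x z]
          by (simp add: Pcoeffs_def matrix_vector_right_distrib inner_add_left inner_add_right inner_commute)
        then show ?thesis
          using iso[OF _ i] x z subspace_add[OF E(1)] by simp
      qed
      then show "P i *v z \<in> F" by (simp add: F_def orthogonal_def)
    qed
  qed
  let ?J = "\<lambda>x. P 0 *v (P 1 *v x)"
  have P01: "P 0 *v (P 1 *v x) = - (P 1 *v (P 0 *v x))" for x
    using P_anticommute[of 0 1 x] m_ge_1 by (simp add: eq_neg_iff_add_eq_0)
  have PP: "P i *v (P i *v x) = x" if "i \<le> m" for i x
    using P_anticommute[OF that that, of x] by (simp add: scaleR_2[symmetric])
  show ?thesis
  proof (rule even_dim_complex_structure)
    show "linear ?J"
      by (rule linear_compose[unfolded o_def]) (rule matrix_vector_mul_linear)+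
    show "?J (?J x) = - x" for x
    proof -
      have "?J (?J x) = - (P 1 *v (P 0 *v (P 0 *v (P 1 *v x))))" by (rule P01)
      then show ?thesis using PP[of 0] PP[of 1] m_ge_1 by simp
    qed
    show "x \<bullet> ?J z = - (?J x \<bullet> z)" for x z
    proof -
      have "x \<bullet> ?J z = (P 1 *v (P 0 *v x)) \<bullet> z" using P_inner[of 0] P_inner[of 1] m_ge_1 by simp
      then show ?thesis unfolding P01 by simp
    qed
    show "?J x \<in> E" if "x \<in> E" for x
    proof -
      have "P 1 *v x \<in> F" using P_F[of 1] m_ge_1 that by blast
      then obtain z where "z \<in> E" "P 1 *v x = P 0 *v z" using P_F[of 0] by auto
      then show ?thesis using PP[of 0 z] by simp
    qed
  qed (rule E)
qed

section \<open>The function F along normal great circles of the focal manifolds\<close>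

lemma clifford_F_of_scaled:
  assumes "norm x = 1" "\<And>i. i \<le> m \<Longrightarrow> Pcoeffs x x i = r * k i"
  shows "clifford_F m P x = 1 - 2 * (r\<^sup>2 * ip k k)"
proof -
  have "ip (Pcoeffs x x) (Pcoeffs x x) = ip (\<lambda>i. r * k i) (\<lambda>i. r * k i)"
    by (rule ip_cong) (simp_all add: assms)
  then show ?thesis
    unfolding clifford_F_eq[OF assms(1)] ip_scale_left ip_scale_right by (simp add: power2_eq_square)
qed

lemma Pcoeffs_expand:
  "Pcoeffs (a *\<^sub>R x + b *\<^sub>R z) (a *\<^sub>R x + b *\<^sub>R z) i
     = a\<^sup>2 * Pcoeffs x x i + 2 * a * b * Pcoeffs x z i + b\<^sup>2 * Pcoeffs z z i" if "i \<le> m"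
  using P_inner[OF that, of z x]
  by (simp add: Pcoeffs_def matrix_vector_right_distrib matrix_vector_mult_scaleR inner_add_left
      inner_add_right inner_commute power2_eq_square algebra_simps)

lemma Pcoeffs_eq_act: "i \<le> m \<Longrightarrow> Pcoeffs x z i = act (\<lambda>j. if j = i then 1 else 0) x \<bullet> z"
  by (simp add: Pcoeffs_def P_eq_act)

text \<open>Since P N = - N, the value <P_i N, N> is the negative of <P_i y, y>, and the cross terms
  <P_i y, N> vanish. So the coefficients along the circle are cos 2t times those of y.\<close>

lemma clifford_F_normal_geodesic:
  assumes y: "y \<in> M_minus m P" and N: "N \<in> normal_M y" "norm N = 1"
  shows "clifford_F m P (cos t *\<^sub>R y + sin t *\<^sub>R N) = - cos (4 * t)"
proof -
  define c where "c = Pcoeffs y y"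
  have c: "norm y = 1" "ip c c = 1" "act c y = y" using M_minusD[OF y] by (simp_all add: c_def)
  have cN: "act c N = - N" using normal_M_D[OF y N(1)] by (simp add: c_def)
  have NN: "act d N \<bullet> N = - ip d c" for d
  proof -
    have "act d N \<bullet> N = - (act d N \<bullet> act c N)" using cN by simp
    then show ?thesis using N by (simp add: act_inner_act norm_eq_1)
  qed
  have "clifford_F m P (cos t *\<^sub>R y + sin t *\<^sub>R N) = 1 - 2 * ((cos (2 * t))\<^sup>2 * ip c c)"
  proof (rule clifford_F_of_scaled)
    show "norm (cos t *\<^sub>R y + sin t *\<^sub>R N) = 1"
      using c N normal_M_D[OF y N(1)] by (intro norm_cos_sin) auto
    fix i assume i: "i \<le> m"
    let ?d = "\<lambda>j. if j = i then 1 else 0 :: real"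
    have "ip ?d c = c i"
      using sum_coordinate_scaleR[of "{..m}" i c] i by (simp add: ip_def)
    then have "Pcoeffs N N i = - c i" "Pcoeffs y N i = 0" "Pcoeffs y y i = c i"
      using NN[of ?d] normal_M_D[OF y N(1)] i by (simp_all add: Pcoeffs_eq_act[of i N] Pcoeffs_eq_act[of i y N] c_def)
    then show "Pcoeffs (cos t *\<^sub>R y + sin t *\<^sub>R N) (cos t *\<^sub>R y + sin t *\<^sub>R N) i = cos (2 * t) * c i"
      unfolding Pcoeffs_expand[OF i] cos_double by (simp add: algebra_simps)
  qed
  also have "\<dots> = - cos (2 * (2 * t))" unfolding cos_double_cos[of "2 * t"] c(2) by simp
  finally show ?thesis by simp
qed

lemma dim_span_P_image: "dim (span ((\<lambda>i. P i *v y) ` {..m})) \<le> m + 1"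
proof -
  have "dim (span ((\<lambda>i. P i *v y) ` {..m})) \<le> card ((\<lambda>i. P i *v y) ` {..m})"
    by (rule dim_le_card) auto
  also have "\<dots> \<le> card {..m}" by (rule card_image_le) simp
  finally show ?thesis by simp
qed

lemma act_in_span: "act d y \<in> span ((\<lambda>i. P i *v y) ` {..m})"
  unfolding act_def by (rule span_sum, rule span_scale, rule span_base) simp

lemma path_from_M_minus:
  assumes y: "y \<in> M_minus m P" and dim: "4 * m + 2 \<le> CARD('n)"
  shows "\<exists>g. continuous_on UNIV g \<and> g 0 = y \<and>
           (\<forall>t. norm (g t) = 1 \<and> clifford_F m P (g t) = - cos (4 * t))"
proof -
  define c where "c = Pcoeffs y y"
  have c: "norm y = 1" "ip c c = 1" "act c y = y" using M_minusD[OF y] by (simp_all add: c_def)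
  define W where "W = span ((\<lambda>i. P i *v y) ` {..m})"
  \<comment> \<open>The bound m >= 1 gives 2(m + 1) < 4m + 2.\<close>
  have "2 * dim W < CARD('n) + 2 * dim ({x. act c x = x} \<inter> W)"
    using dim_span_P_image[of y] dim m_ge_1 by (simp add: W_def)
  then have "\<exists>N. norm N = 1 \<and> act c N = - N \<and> (\<forall>w\<in>W. w \<bullet> N = 0)"
    by (rule anti_fixed_exists[OF c(2), rotated]) (auto simp: W_def)
  then obtain N where N: "norm N = 1" "act c N = - N" "\<forall>w\<in>W. w \<bullet> N = 0"
    by auto
  then have N_normal: "N \<in> normal_M y"
    using act_in_span by (simp add: normal_M_def c_def W_def)
  let ?g = "\<lambda>t. cos t *\<^sub>R y + sin t *\<^sub>R N"
  have "continuous_on UNIV ?g" by (intro continuous_intros)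
  moreover have "norm (?g t) = 1" for t
    using c N normal_M_D[OF y N_normal] by (intro norm_cos_sin) auto
  ultimately show ?thesis
    using clifford_F_normal_geodesic[OF y N_normal N(1)] by (intro exI[of _ ?g]) simp
qed

lemma M_plus_iff: "x \<in> level m P 1 \<longleftrightarrow> norm x = 1 \<and> (\<forall>i\<le>m. Pcoeffs x x i = 0)"
proof -
  have "ip (Pcoeffs x x) (Pcoeffs x x) = 0 \<longleftrightarrow> (\<forall>i\<le>m. Pcoeffs x x i = 0)"
    using ip_self_eq_0 by (auto simp: ip_def)
  then show ?thesis by (auto simp: level_def clifford_F_eq)
qed

text \<open>M_+ is cut out of the sphere by the equations <P_i x, x> = 0, so P_0 z is a normal
  direction. Along its circle only the cross terms survive: the coefficients are sin 2t times the
  coefficients \<open>e\<close> of P_0.\<close>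

lemma path_from_M_plus:
  assumes z: "z \<in> level m P 1"
  shows "\<exists>g. continuous_on UNIV g \<and> g 0 = z \<and>
           (\<forall>t. norm (g t) = 1 \<and> clifford_F m P (g t) = cos (4 * t))"
proof -
  define e where "e = (\<lambda>j::nat. if j = 0 then 1 else 0 :: real)"
  have z1: "norm z = 1" "z \<bullet> z = 1" using z by (auto simp: M_plus_iff norm_eq_1)
  have ip_e: "ip d e = d 0" for d by (simp add: ip_def e_def if_distrib cong: if_cong)
  have zz: "act d z \<bullet> z = 0" for d
    unfolding act_inner_Pcoeffs using z by (simp add: M_plus_iff ip_def)
  let ?g = "\<lambda>t. cos t *\<^sub>R z + sin t *\<^sub>R act e z"
  have ee: "ip e e = 1" using ip_e[of e] by (simp add: e_def)
  have norm_g: "norm (?g t) = 1" for t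
  proof (rule norm_cos_sin)
    show "norm (act e z) = 1" using z1 ee by (simp add: norm_eq_1 act_inner_act)
    show "z \<bullet> act e z = 0" using zz[of e] by (simp add: inner_commute)
  qed (rule z1)
  have "clifford_F m P (?g t) = cos (4 * t)" for t
  proof -
    have "clifford_F m P (?g t) = 1 - 2 * ((sin (2 * t))\<^sup>2 * ip e e)"
    proof (rule clifford_F_of_scaled[OF norm_g])
      fix i assume i: "i \<le> m"
      let ?d = "\<lambda>j. if j = i then 1 else 0 :: real"
      have "act ?d (act e z) \<bullet> act e z = act e (act ?d (act e z)) \<bullet> z" by (simp add: act_inner)
      also have "\<dots> = 0"
        unfolding act_swap[of e ?d] by (simp add: inner_diff_left act_act act_simps zz)
      finally have "Pcoeffs (act e z) (act e z) i = 0" using i by (simp add: Pcoeffs_eq_act)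
      moreover have "Pcoeffs z (act e z) i = e i" using i z1 by (simp add: Pcoeffs_act)
      moreover have "Pcoeffs z z i = 0" using z i by (simp add: M_plus_iff)
      ultimately show "Pcoeffs (?g t) (?g t) i = sin (2 * t) * e i"
        unfolding Pcoeffs_expand[OF i] sin_double by simp
    qed
    also have "\<dots> = cos (2 * (2 * t))" unfolding cos_double_sin[of "2 * t"] ee by simp
    finally show ?thesis by simp
  qed
  moreover have "continuous_on UNIV ?g" by (intro continuous_intros)
  ultimately show ?thesis using norm_g by (intro exI[of _ ?g]) simp
qed

lemma clifford_F_bounds:
  assumes "norm x = 1"
  shows "-1 \<le> clifford_F m P x" "clifford_F m P x \<le> 1"
  using Pcoeffs_ip_le[OF assms] ip_self_nonneg[of "Pcoeffs x x"] by (simp_all add: clifford_F_eq[OF assms])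

text \<open>The hypersurfaces fill the sphere outside the two focal manifolds. So the family
  determines the union of these, which does not yet tell them apart.\<close>

lemma in_focal_iff:
  assumes "norm x = 1"
  shows "x \<in> \<Union> (isoparametric_family m P) \<longleftrightarrow> x \<notin> M_minus m P \<and> x \<notin> level m P 1"
  using clifford_F_bounds[OF assms] assms
  by (auto simp: isoparametric_family_def level_def M_minus_def)

lemma M_minus_nonempty: "\<exists>y. y \<in> M_minus m P"
proof -
  define c where "c = (\<lambda>j::nat. if j = 0 then 1 else 0 :: real)"
  have c: "ip c c = 1" by (simp add: ip_def c_def if_distrib cong: if_cong)
  have "dim {x. act c x = x} \<noteq> 0" 
    using dim_fixed[OF c] zero_less_card_finite[where 'a='n] by linarith
  then obtain x where x: "act c x = x" "x \<noteq> 0" by (auto simp: dim_eq_0)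
  have "(1 / norm x) *\<^sub>R x \<in> M_minus m P"
    using x c by (intro M_minusI[of _ c]) (simp_all add: act_simps)
  then show ?thesis ..
qed

end

text \<open>
  If \<open>M\<^sub>-(P) = M\<^sub>+(Q)\<close>, then \<open>E\<^sub>+(A)\<close> is \<open>Q\<close>-isotropic for \<open>A \<in> \<Sigma>(P)\<close>, so \<open>Q\<^sub>0Q\<^sub>1\<close> is a complex structure on it and
  \<open>l\<close> is even, whence \<open>m + m' + 2 \<le> l\<close>. This leaves room for a direction \<open>v\<close> at \<open>y \<in> M\<^sub>-(P)\<close> that is normal for
  both systems; the point \<open>(y + v)/\<surd>2\<close> is then in \<open>M\<^sub>+(P)\<close> but not in \<open>M\<^sub>-(Q)\<close>.
\<close>

lemma focal_not_swapped:
  fixes P Q :: "nat \<Rightarrow> real^'n^'n"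
  assumes "clifford_system m P" "clifford_system m' Q"
    and l: "CARD('n) = 2 * l" "2 * m + 1 \<le> l" "2 * m' + 1 \<le> l"
    and swap: "M_minus m P \<subseteq> level m' Q 1" "level m P 1 \<subseteq> M_minus m' Q"
  shows False
proof -
  interpret P: clifford m P by unfold_locales fact
  interpret Q: clifford m' Q by unfold_locales fact
  obtain y where y: "y \<in> M_minus m P" using P.M_minus_nonempty by blast
  define c where "c = P.Pcoeffs y y"
  have c: "norm y = 1" "P.ip c c = 1" "P.act c y = y" using P.M_minusD[OF y] by (simp_all add: c_def)
  let ?E = "{x. P.act c x = x}"
  have E: "subspace ?E" using P.subspace_eigen[of c 1] by simp
  have "even (dim ?E)"
  proof (rule Q.isotropic_even[OF E P.dim_fixed[OF c(2)]])
    fix x i assume x: "x \<in> ?E" and i: "i \<le> m'"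
    show "Q.Pcoeffs x x i = 0"
    proof (cases "x = 0")
      case False
      then have "(1 / norm x) *\<^sub>R x \<in> M_minus m P"
        using x c by (intro P.M_minusI[of _ c]) (simp_all add: P.act_simps)
      then have "Q.Pcoeffs ((1 / norm x) *\<^sub>R x) ((1 / norm x) *\<^sub>R x) i = 0"
        using swap(1) i by (auto simp: Q.M_plus_iff)
      then show ?thesis using False by (simp add: Q.Pcoeffs_def matrix_vector_mult_scaleR)
    qed (simp add: Q.Pcoeffs_def)
  qed
  then have "even l" using P.dim_fixed[OF c(2)] l(1) by simp
  \<comment> \<open>As l is even, 2m + 1 <= l and 2m' + 1 <= l improve to 2m + 2 <= l and 2m' + 2 <=
    l; the claim is half their sum.\<close>
  then have ml: "m + m' + 2 \<le> l" using l by presburger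
  let ?SP = "(\<lambda>i. P i *v y) ` {..m}" and ?SQ = "(\<lambda>i. Q i *v y) ` {..m'}"
  define W where "W = {u + w |u w. u \<in> span ?SP \<and> w \<in> span ?SQ}"
  have W: "subspace W" unfolding W_def by (intro subspace_sums subspace_span)
  have "dim W + dim (span ?SP \<inter> span ?SQ) = dim (span ?SP) + dim (span ?SQ)"
    unfolding W_def by (intro dim_sums_Int subspace_span)
  then have dimW: "dim W \<le> (m + 1) + (m' + 1)"
    using P.dim_span_P_image[of y] Q.dim_span_P_image[of y] by linarith
  have SW: "P.act d y \<in> W" "Q.act d y \<in> W" for d
  proof -
    have "P.act d y = P.act d y + 0" "Q.act d y = 0 + Q.act d y" by simp_all
    then show "P.act d y \<in> W" "Q.act d y \<in> W"
      unfolding W_def using P.act_in_span Q.act_in_span span_zero by blast+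
  qed
  have "dim (?E \<inter> W) \<noteq> 0"
  proof
    assume "dim (?E \<inter> W) = 0"
    then have "?E \<inter> W \<subseteq> {0}" by (simp add: dim_eq_0)
    moreover have "y \<in> ?E \<inter> W" using SW(1)[of c] c by simp
    ultimately show False using c by auto
  qed
  \<comment> \<open>The vector y in the intersection of E_+(P) and W makes the inequality strict:
    2(m + m' + 2) <= 2l < 2l + 2.\<close>
  then have "2 * dim W < CARD('n) + 2 * dim (?E \<inter> W)" using dimW ml l(1) by linarith
  then have "\<exists>v. norm v = 1 \<and> P.act c v = - v \<and> (\<forall>w\<in>W. w \<bullet> v = 0)"
    by (rule P.anti_fixed_exists[OF c(2) W]) auto
  then obtain v where v: "norm v = 1" "P.act c v = - v" "\<forall>w\<in>W. w \<bullet> v = 0" by auto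
  then have vN: "v \<in> P.normal_M y" using SW by (simp add: P.normal_M_def c_def)
  \<comment> \<open>At t = pi / 4 the function - cos 4t reaches 1, the level of M_+(P).\<close>
  let ?x = "cos (pi / 4) *\<^sub>R y + sin (pi / 4) *\<^sub>R v"
  have "norm ?x = 1"
    using c v P.normal_M_D[OF y vN] by (intro norm_cos_sin) auto
  moreover have "clifford_F m P ?x = 1"
    using P.clifford_F_normal_geodesic[OF y vN v(1), of "pi / 4"] by simp
  ultimately have "?x \<in> M_minus m' Q" using swap(2) by (auto simp: level_def)
  then have "clifford_F m' Q ?x = - 1" by (simp add: M_minus_def level_def)
  \<comment> \<open>Only the term of v survives in the coefficients, with weight sin^2 (pi / 4) =
    1/2, so F of Q at this point is at least 1/2 and not -1.\<close>
  moreover have "clifford_F m' Q ?x = 1 - 2 * ((1/2)\<^sup>2 * Q.ip (Q.Pcoeffs v v) (Q.Pcoeffs v v))"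
  proof (rule Q.clifford_F_of_scaled[OF \<open>norm ?x = 1\<close>])
    fix i assume i: "i \<le> m'"
    have "Q.Pcoeffs y y i = 0" using y swap(1) i by (auto simp: Q.M_plus_iff)
    moreover have "Q.Pcoeffs y v i = 0" using v(3) SW(2) i by (simp add: Q.Pcoeffs_eq_act)
    moreover have "(sin (pi / 4))\<^sup>2 = (1 / 2 :: real)" by (simp add: sin_45 power_divide)
    ultimately show "Q.Pcoeffs ?x ?x i = 1 / 2 * Q.Pcoeffs v v i"
      unfolding Q.Pcoeffs_expand[OF i] by simp
  qed
  ultimately show False using Q.Pcoeffs_ip_le[OF v(1)] by (simp add: power_divide)
qed

section \<open>Two systems with the same family of levels\<close>

lemma continuous_on_clifford_F: "continuous_on S (clifford_F m P)"
  unfolding clifford_F_def[abs_def] by (intro continuous_intros)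

text \<open>A common hypersurface may carry different parameters in the two systems, but it is a
  level of both functions.\<close>

lemma same_family_level_eq:
  assumes fam: "isoparametric_family m' Q = isoparametric_family m P"
    and x: "norm x = 1" "clifford_F m P x = c" and y: "norm y = 1" "clifford_F m P y = c"
    and c: "-1 < c" "c < 1"
  shows "clifford_F m' Q x = clifford_F m' Q y"
proof -
  have "level m P c \<in> isoparametric_family m' Q"
    unfolding fam using c by (auto simp: isoparametric_family_def)
  then obtain c' where "level m P c = level m' Q c'" by (auto simp: isoparametric_family_def)
  moreover have "x \<in> level m P c" "y \<in> level m P c" using x y by (auto simp: level_def)
  ultimately show ?thesis by (simp add: level_def)
qed

text \<open>Points of one focal manifold are limits, at the same speed, of points on common levels.\<close>

lemma same_family_focal_const:
  assumes fam: "isoparametric_family m' Q = isoparametric_family m P"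
    and s: "s = 1 \<or> s = -1"
    and g: "continuous_on UNIV g" "g 0 = x" "\<forall>t. norm (g t) = 1 \<and> clifford_F m P (g t) = s * cos (4 * t)"
    and h: "continuous_on UNIV h" "h 0 = y" "\<forall>t. norm (h t) = 1 \<and> clifford_F m P (h t) = s * cos (4 * t)"
  shows "clifford_F m' Q x = clifford_F m' Q y"
proof -
  let ?D = "\<lambda>t::real. clifford_F m' Q (g t) - clifford_F m' Q (h t)"
  have "continuous_on UNIV ?D"
    by (intro continuous_intros continuous_on_compose2[OF continuous_on_clifford_F[of UNIV]] g h) auto
  then have "(?D \<longlongrightarrow> ?D 0) (at_right 0)"
    by (auto simp: continuous_on_def intro: tendsto_within_subset)
  moreover have "\<forall>\<^sub>F t in at_right 0. ?D t = 0"
  proof -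
    \<comment> \<open>On this interval \<open>s * cos (4 * t)\<close> stays strictly between -1 and
      1, so both points lie on one hypersurface of the family.\<close>
    have "?D t = 0" if "t \<in> {0<..<pi/4}" for t
    proof -
      have "cos (4 * t) < 1" "-1 < cos (4 * t)"
        using cos_monotone_0_pi[of 0 "4 * t"] cos_monotone_0_pi[of "4 * t" pi] that by auto
      then show ?thesis
        using same_family_level_eq[OF fam, of "g t" "s * cos (4 * t)" "h t"] g h s by auto
    qed
    then show ?thesis using eventually_at_right_real[of 0 "pi / 4"] pi_gt_zero
      by (auto elim: eventually_mono)
  qed
  then have "(?D \<longlongrightarrow> 0) (at_right 0)" by (rule tendsto_eventually)
  ultimately have "?D 0 = 0" by (rule tendsto_unique[OF trivial_limit_at_right_real])
  then show ?thesis using g h by simp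
qed

text \<open>F of Q is constant on M_-(P), and F of P on M_-(Q). If these manifolds share a point,
  both constants are -1 and they coincide. Otherwise each lies in the other system's M_+, and since
  F of Q is also constant on M_+(P), which now contains M_-(Q), the interchange is complete.\<close>

lemma same_family_M_minus:
  fixes P Q :: "nat \<Rightarrow> real^'n^'n"
  assumes P: "clifford_system m P" and Q: "clifford_system m' Q"
    and l: "CARD('n) = 2 * l" "2 * m + 1 \<le> l" "2 * m' + 1 \<le> l"
    and fam: "isoparametric_family m' Q = isoparametric_family m P"
  shows "M_minus m' Q = M_minus m P"
proof -
  interpret P: clifford m P by unfold_locales fact
  interpret Q: clifford m' Q by unfold_locales fact
  have focal: "x \<in> M_minus m' Q \<or> x \<in> level m' Q 1 \<longleftrightarrow> x \<in> M_minus m P \<or> x \<in> level m P 1" for x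
    using P.in_focal_iff[of x] Q.in_focal_iff[of x] fam by (auto simp: M_minus_def level_def)
  have minus: "clifford_F m'' Q' x = clifford_F m'' Q' y"
    if "isoparametric_family m'' Q' = isoparametric_family m0 P0" "clifford_system m0 P0" "2 * m0 + 1 \<le> l"
      "x \<in> M_minus m0 P0" "y \<in> M_minus m0 P0" for m'' m0 and Q' P0 :: "nat \<Rightarrow> real^'n^'n" and x y
  proof -
    interpret P0: clifford m0 P0 by unfold_locales fact
    have "4 * m0 + 2 \<le> CARD('n)" using that(3) l(1) by simp
    from P0.path_from_M_minus[OF that(4) this] P0.path_from_M_minus[OF that(5) this]
    show ?thesis using same_family_focal_const[OF that(1), of "-1" _ x _ y] by auto
  qed
  have plus: "clifford_F m' Q x = clifford_F m' Q y" if "x \<in> level m P 1" "y \<in> level m P 1" for x y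
    using P.path_from_M_plus[OF that(1)] P.path_from_M_plus[OF that(2)]
      same_family_focal_const[OF fam, of 1 _ x _ y] by auto
  have minusQ: "clifford_F m' Q x = clifford_F m' Q y" if "x \<in> M_minus m P" "y \<in> M_minus m P" for x y
    using minus[OF fam P l(2)] that by blast
  have minusP: "clifford_F m P x = clifford_F m P y" if "x \<in> M_minus m' Q" "y \<in> M_minus m' Q" for x y
    using minus[OF fam[symmetric] Q l(3)] that by blast
  obtain p where p: "p \<in> M_minus m P" using P.M_minus_nonempty by blast
  obtain q where q: "q \<in> M_minus m' Q" using Q.M_minus_nonempty by blast
  show ?thesis
  proof (cases "\<exists>x. x \<in> M_minus m P \<and> x \<in> M_minus m' Q")
    case True
    then obtain x where x: "x \<in> M_minus m P" "x \<in> M_minus m' Q" by blast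
    have "y \<in> M_minus m' Q" if "y \<in> M_minus m P" for y
      using minusQ[OF x(1) that] x that by (simp add: M_minus_def level_def)
    moreover have "y \<in> M_minus m P" if "y \<in> M_minus m' Q" for y
      using minusP[OF x(2) that] x that by (simp add: M_minus_def level_def)
    ultimately show ?thesis by blast
  next
    case False
    then have "M_minus m P \<subseteq> level m' Q 1" and q': "q \<in> level m P 1"
      using focal q by blast+
    moreover have "level m P 1 \<subseteq> M_minus m' Q"
    proof
      fix z assume z: "z \<in> level m P 1"
      then show "z \<in> M_minus m' Q"
        using plus[OF z q'] q by (simp add: M_minus_def level_def)
    qed
    ultimately show ?thesis using focal_not_swapped[OF P Q l] by blast
  qed
qed

section \<open>Recovering the Clifford system\<close>

context clifford begin

lemma comb_cong: "(\<And>i. i \<le> m \<Longrightarrow> c i = d i) \<Longrightarrow> comb c = comb d"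
  by (simp add: comb_def)

lemma clifford_span_eq_span_sphere: "clifford_span m P = span (clifford_sphere m P)"
proof
  have "P i \<in> clifford_sphere m P" if "i \<le> m" for i
    using sum_coordinate_scaleR[of "{..m}" i "\<lambda>j. if j = i then 1 else 0 :: real"] that
    by (auto simp: clifford_sphere_eq P_eq_comb[OF that] ip_def
        intro!: exI[of _ "\<lambda>j. if j = i then 1 else 0"])
  then show "clifford_span m P \<subseteq> span (clifford_sphere m P)"
    unfolding clifford_span_def by (intro span_mono) auto
  show "span (clifford_sphere m P) \<subseteq> clifford_span m P"
    unfolding clifford_span_def by (intro span_minimal) (auto simp: clifford_sphere_def clifford_span_def)
qed

text \<open>The vectors P_i y are orthogonal and nonzero, so evaluating the span at y reveals m.
  This is how equal spheres yield equal m.\<close>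

lemma dim_clifford_span_image:
  assumes "y \<noteq> 0"
  shows "dim ((\<lambda>X. X *v y) ` clifford_span m P) = m + 1"
proof -
  let ?S = "(\<lambda>i. P i *v y) ` {..m}"
  have orth: "(P i *v y) \<bullet> (P j *v y) = (if i = j then y \<bullet> y else 0)" if "i \<le> m" "j \<le> m" for i j
    using act_inner_P[OF that(2), of "\<lambda>k. if k = i then 1 else 0" y] that by (simp add: P_eq_act)
  have inj: "inj_on (\<lambda>i. P i *v y) {..m}"
  proof (rule inj_onI)
    fix i j assume ij: "i \<in> {..m}" "j \<in> {..m}" "P i *v y = P j *v y"
    then show "i = j" using orth[of i i] orth[of i j] assms by (auto split: if_splits)
  qed
  have "independent ?S"
  proof (rule pairwise_orthogonal_independent)
    show "pairwise orthogonal ?S" using orth by (auto simp: pairwise_def orthogonal_def)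
    show "0 \<notin> ?S"
    proof
      assume "0 \<in> ?S"
      then obtain i where "i \<le> m" "P i *v y = 0" by auto
      then show False using orth[of i i] assms by simp
    qed
  qed
  then have "dim (span ?S) = m + 1"
    using card_image[OF inj] by (simp add: dim_eq_card_independent)
  moreover have "range (\<lambda>d. act d y) = span ?S"
  proof
    show "range (\<lambda>d. act d y) \<subseteq> span ?S"
      using act_in_span by auto
    have "subspace (range (\<lambda>d. act d y))"
    proof (rule subspaceI)
      have "act (\<lambda>i. 0) y = 0" by (rule act_coeffs_0)
      then show "0 \<in> range (\<lambda>d. act d y)" by (metis rangeI)
    qed (auto simp flip: act_coeff_add act_coeff_scale)
    then show "span ?S \<subseteq> range (\<lambda>d. act d y)"
      by (intro span_minimal) (auto simp: P_eq_act)
  qed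
  ultimately show ?thesis by (simp add: clifford_span_eq image_image comb_mult_vec)
qed

lemma endo_inner_P_comb: "i \<le> m \<Longrightarrow> endo_inner (P i) (comb c) = c i"
  using sum_coordinate_scaleR[of "{..m}" i c]
  by (simp add: P_eq_comb endo_inner_comb) (simp add: ip_def)

end

lemma clifford_sphere_eq_of_E_plus_eq:
  fixes P Q :: "nat \<Rightarrow> real^'n^'n"
  assumes "clifford_system m P" "clifford_system m' Q"
    and E: "E_plus ` clifford_sphere m' Q = E_plus ` clifford_sphere m P"
  shows "clifford_sphere m' Q = clifford_sphere m P"
proof -
  interpret P: clifford m P by unfold_locales fact
  interpret Q: clifford m' Q by unfold_locales fact
  have eq: "A = B" if "A \<in> clifford_sphere m' Q" "B \<in> clifford_sphere m P" "E_plus A = E_plus B" for A B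
    using symmetric_involution_eqI Q.clifford_sphere_involution[OF that(1)]
      P.clifford_sphere_involution[OF that(2)] that(3) by blast
  show ?thesis
  proof (intro set_eqI iffI)
    fix A assume A: "A \<in> clifford_sphere m' Q"
    then obtain B where "B \<in> clifford_sphere m P" "E_plus A = E_plus B" using E by (metis image_iff)
    then show "A \<in> clifford_sphere m P" using eq[OF A] by simp
  next
    fix B assume B: "B \<in> clifford_sphere m P"
    then obtain A where "A \<in> clifford_sphere m' Q" "E_plus B = E_plus A" using E by (metis image_iff)
    then show "B \<in> clifford_sphere m' Q" using eq[OF _ B] by simp
  qed
qed

text \<open>A unit vector y of E_+(A) lies in the common M_-, so some B in the other sphere fixes
  it. The direct sum then describes E_+(A) and E_+(B) by the same data of the same manifold at
  y.\<close>

lemma E_plus_of_M_minus_eq: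
  fixes P Q :: "nat \<Rightarrow> real^'n^'n"
  assumes "clifford_system m P" "clifford_system m' Q"
    and dim: "4 * m + 2 \<le> CARD('n)" "4 * m' + 2 \<le> CARD('n)"
    and M: "M_minus m' Q = M_minus m P" and A: "A \<in> clifford_sphere m P"
  shows "\<exists>B\<in>clifford_sphere m' Q. E_plus B = E_plus A"
proof -
  interpret P: clifford m P by unfold_locales fact
  interpret Q: clifford m' Q by unfold_locales fact
  obtain c where c: "A = P.comb c" "P.ip c c = 1" using A by (auto simp: P.clifford_sphere_eq)
  have "dim {x. P.act c x = x} \<noteq> 0"
    using P.dim_fixed[OF c(2)] zero_less_card_finite[where 'a='n] by linarith
  then obtain x where x: "P.act c x = x" "x \<noteq> 0" by (auto simp: dim_eq_0)
  define y where "y = (1 / norm x) *\<^sub>R x"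
  have y: "norm y = 1" "y \<in> E_plus A" using x by (simp_all add: y_def c P.E_plus_comb P.act_simps)
  then have "y \<in> M_minus m' Q" using A M by (auto simp: P.M_minus_iff_E_plus)
  then obtain B where B: "B \<in> clifford_sphere m' Q" "y \<in> E_plus B" by (auto simp: Q.M_minus_iff_E_plus)
  have "E_plus B = E_plus A"
    using P.direct_sum_E_plus[OF A y(2,1) dim(1)] Q.direct_sum_E_plus[OF B y(1) dim(2)] M
    by (simp add: is_direct_sum_def)
  with B show ?thesis by blast
qed

lemma clifford_sphere_eq_of_family_eq:
  fixes P Q :: "nat \<Rightarrow> real^'n^'n"
  assumes P: "clifford_system m P" and Q: "clifford_system m' Q"
    and l: "CARD('n) = 2 * l" "2 * m + 1 \<le> l" "2 * m' + 1 \<le> l"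
    and fam: "isoparametric_family m' Q = isoparametric_family m P"
  shows "clifford_sphere m' Q = clifford_sphere m P"
proof (rule clifford_sphere_eq_of_E_plus_eq[OF P Q])
  have M: "M_minus m' Q = M_minus m P" by (rule same_family_M_minus[OF P Q l fam])
  have dim: "4 * m + 2 \<le> CARD('n)" "4 * m' + 2 \<le> CARD('n)" using l by simp_all
  show "E_plus ` clifford_sphere m' Q = E_plus ` clifford_sphere m P"
  proof (rule equalityI; rule image_subsetI)
    show "E_plus A \<in> E_plus ` clifford_sphere m P" if "A \<in> clifford_sphere m' Q" for A
      using E_plus_of_M_minus_eq[OF Q P dim(2,1) M[symmetric] that] by (metis imageI)
    show "E_plus A \<in> E_plus ` clifford_sphere m' Q" if "A \<in> clifford_sphere m P" for A
      using E_plus_of_M_minus_eq[OF P Q dim M that] by (metis imageI)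
  qed
qed

text \<open>Pulling \<open>Q\<close> back along \<open>A\<close> turns congruence of the families
  into equality.\<close>

definition conjugate :: "real^'n^'n \<Rightarrow> (nat \<Rightarrow> real^'n^'n) \<Rightarrow> nat \<Rightarrow> real^'n^'n" where
  "conjugate A Q i = transpose A ** Q i ** A"

lemma orthogonal_matrix_mult_vec:
  fixes A :: "real^'n^'n"
  assumes "orthogonal_matrix A"
  shows "transpose A *v (A *v x) = x" "A *v (transpose A *v x) = x"
    "(A *v x) \<bullet> (A *v y) = x \<bullet> y" "norm (A *v x) = norm x"
proof -
  show 1: "transpose A *v (A *v x) = x" "A *v (transpose A *v x) = x" for x
    using assms by (simp_all add: orthogonal_matrix_def matrix_vector_mul_assoc del: transpose_matrix_vector)
  show 2: "(A *v x) \<bullet> (A *v y) = x \<bullet> y" for x y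
    by (simp only: dot_lmul_matrix[symmetric] transpose_matrix_vector[symmetric] 1)
  show "norm (A *v x) = norm x" by (simp add: norm_eq_sqrt_inner 2)
qed

lemma clifford_system_conjugate:
  fixes A :: "real^'n^'n"
  assumes A: "orthogonal_matrix A" and Q: "clifford_system m Q"
  shows "clifford_system m (conjugate A Q)"
  unfolding clifford_system_def
proof (intro conjI allI impI)
  show "1 \<le> m" using Q by (simp add: clifford_system_def)
  show "transpose (conjugate A Q i) = conjugate A Q i" if "i \<le> m" for i
    using Q that by (simp add: clifford_system_def conjugate_def matrix_transpose_mul matrix_mul_assoc)
  fix i j assume ij: "i \<le> m" "j \<le> m"
  have mult: "conjugate A Q i ** conjugate A Q j = transpose A ** (Q i ** Q j) ** A" for i j
    using orthogonal_matrix_mult_vec[OF A]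
    by (simp add: matrix_eq conjugate_def matrix_vector_mul_assoc[symmetric]
        del: transpose_matrix_vector)
  have "conjugate A Q i ** conjugate A Q j + conjugate A Q j ** conjugate A Q i
      = transpose A ** (Q i ** Q j + Q j ** Q i) ** A"
    by (simp add: mult matrix_eq matrix_vector_mul_assoc[symmetric] matrix_vector_mult_add_rdistrib
        matrix_vector_right_distrib del: transpose_matrix_vector)
  also have "\<dots> = transpose A ** (if i = j then 2 *\<^sub>R mat 1 else 0) ** A"
    using Q ij by (simp add: clifford_system_def)
  also have "\<dots> = (if i = j then 2 *\<^sub>R mat 1 else 0)"
    using orthogonal_matrix_mult_vec[OF A]
    by (simp add: matrix_eq matrix_vector_mul_assoc[symmetric] scaleR_matrix_vector_assoc[symmetric]
        matrix_vector_mult_scaleR del: transpose_matrix_vector)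
  finally show "conjugate A Q i ** conjugate A Q j + conjugate A Q j ** conjugate A Q i
      = (if i = j then 2 *\<^sub>R mat 1 else 0)" .
qed

lemma level_conjugate:
  fixes A :: "real^'n^'n"
  assumes A: "orthogonal_matrix A"
  shows "level m (conjugate A Q) c = (\<lambda>x. transpose A *v x) ` level m Q c"
proof -
  have "(conjugate A Q i *v x) \<bullet> x = (Q i *v (A *v x)) \<bullet> (A *v x)" for i x
    unfolding conjugate_def matrix_vector_mul_assoc[symmetric]
    by (simp add: transpose_matrix_vector dot_lmul_matrix)
  then have F: "clifford_F m (conjugate A Q) x = clifford_F m Q (A *v x)" for x
    using orthogonal_matrix_mult_vec[OF A] by (simp add: clifford_F_def)
  have iff: "x \<in> level m (conjugate A Q) c \<longleftrightarrow> A *v x \<in> level m Q c" for x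
    using orthogonal_matrix_mult_vec[OF A] by (simp add: level_def F)
  show ?thesis
  proof (intro set_eqI iffI)
    fix x assume "x \<in> level m (conjugate A Q) c"
    then show "x \<in> (\<lambda>x. transpose A *v x) ` level m Q c"
      using iff orthogonal_matrix_mult_vec(1)[OF A] by (metis imageI)
  next
    fix x assume "x \<in> (\<lambda>x. transpose A *v x) ` level m Q c"
    then show "x \<in> level m (conjugate A Q) c"
      using iff orthogonal_matrix_mult_vec(2)[OF A] by (auto simp del: transpose_matrix_vector)
  qed
qed

lemma family_conjugate:
  fixes A :: "real^'n^'n"
  assumes A: "orthogonal_matrix A"
    and fam: "(\<lambda>M. (\<lambda>x. A *v x) ` M) ` isoparametric_family m P = isoparametric_family m' Q"
  shows "isoparametric_family m' (conjugate A Q) = isoparametric_family m P"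
proof -
  have "isoparametric_family m' (conjugate A Q)
      = (\<lambda>M. (\<lambda>x. transpose A *v x) ` M) ` isoparametric_family m' Q"
    by (simp add: isoparametric_family_def image_image level_conjugate[OF A]
        del: transpose_matrix_vector)
  also have "\<dots> = isoparametric_family m P"
    unfolding fam[symmetric] by (simp add: image_image orthogonal_matrix_mult_vec[OF A] del: transpose_matrix_vector)
  finally show ?thesis .
qed

text \<open>\<open>B\<close> keeps coefficients, replacing the basis P_i by the conjugate system.
  Both bases are orthonormal for \<open>endo_inner\<close>, and equal spheres have equal spans, so
  \<open>B\<close> is an orthogonal transformation of the common span.\<close>

lemma geometrically_equivalent_conjugate:
  fixes P Q :: "nat \<Rightarrow> real^'n^'n"
  assumes A: "orthogonal_matrix A" and "clifford_system m P" "clifford_system m (conjugate A Q)"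
    and sphere: "clifford_sphere m (conjugate A Q) = clifford_sphere m P"
  shows "geometrically_equivalent m P Q"
proof -
  interpret P: clifford m P by unfold_locales fact
  interpret R: clifford m "conjugate A Q" by unfold_locales fact
  define B where "B X = R.comb (\<lambda>i. endo_inner (P i) X)" for X
  have B: "B (P.comb c) = R.comb c" for c
    unfolding B_def by (rule R.comb_cong) (simp add: P.endo_inner_P_comb)
  have span: "range P.comb = range R.comb"
    using P.clifford_span_eq R.clifford_span_eq P.clifford_span_eq_span_sphere
      R.clifford_span_eq_span_sphere sphere by simp
  have "orthogonal_transformation_of (clifford_span m P) B"
    unfolding orthogonal_transformation_of_def P.clifford_span_eq
  proof (intro conjI ballI allI)
    show "B ` range P.comb = range P.comb" unfolding span[symmetric] image_image B using span by simp
  next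
    fix X Y assume "X \<in> range P.comb" "Y \<in> range P.comb"
    then obtain c d where cd: "X = P.comb c" "Y = P.comb d" by blast
    show "B (X + Y) = B X + B Y"
      unfolding cd P.comb_coeff_add[symmetric] B by (rule R.comb_coeff_add)
    show "endo_inner (B X) (B Y) = endo_inner X Y"
      unfolding cd B P.endo_inner_comb R.endo_inner_comb ..
  next
    fix r X assume "X \<in> range P.comb"
    then obtain c where c: "X = P.comb c" by blast
    show "B (r *\<^sub>R X) = r *\<^sub>R B X"
      unfolding c P.comb_coeff_scale[symmetric] B by (rule R.comb_coeff_scale)
  qed
  moreover have "Q i = A ** B (P i) ** transpose A" if "i \<le> m" for i
  proof -
    have "B (P i) = conjugate A Q i"
      using B[of "\<lambda>j. if j = i then 1 else 0"] that
      by (simp flip: P.P_eq_comb R.P_eq_comb)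
    then show ?thesis
      using orthogonal_matrix_mult_vec[OF A]
      by (simp add: matrix_eq conjugate_def matrix_vector_mul_assoc[symmetric]
        del: transpose_matrix_vector)
  qed
  ultimately show ?thesis using A unfolding geometrically_equivalent_def by blast
qed

lemma congruent_families_imp_equivalent:
  fixes P Q :: "nat \<Rightarrow> real^'n^'n"
  assumes P: "clifford_system m P" and Q: "clifford_system m' Q"
    and l: "CARD('n) = 2 * l" "2 * m + 1 \<le> l" "2 * m' + 1 \<le> l"
    and cong: "congruent_families (isoparametric_family m P) (isoparametric_family m' Q)"
  shows "m' = m \<and> geometrically_equivalent m P Q"
proof -
  obtain A where A: "orthogonal_matrix A"
    and fam: "(\<lambda>M. (\<lambda>x. A *v x) ` M) ` isoparametric_family m P = isoparametric_family m' Q"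
    using cong by (auto simp: congruent_families_def)
  have R: "clifford_system m' (conjugate A Q)" by (rule clifford_system_conjugate[OF A Q])
  have sphere: "clifford_sphere m' (conjugate A Q) = clifford_sphere m P"
    by (rule clifford_sphere_eq_of_family_eq[OF P R l family_conjugate[OF A fam]])
  interpret P: clifford m P by unfold_locales fact
  interpret R: clifford m' "conjugate A Q" by unfold_locales fact
  obtain y where "y \<in> M_minus m P" using P.M_minus_nonempty by blast
  then have "y \<noteq> 0" using P.M_minusD(1) by force
  \<comment> \<open>Equal spheres have equal spans; evaluated at y these have dimensions m + 1 and
    m' + 1.\<close>
  then have "m' = m"
    using P.dim_clifford_span_image R.dim_clifford_span_image sphere
    by (simp add: P.clifford_span_eq_span_sphere R.clifford_span_eq_span_sphere)
  with geometrically_equivalent_conjugate[OF A P] R sphere show ?thesis by blast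
qed

theorem theorem4p6:
  fixes P :: "nat \<Rightarrow> real^'n^'n" and l m :: nat
  assumes dim: "CARD('n) = 2 * l"
    and cliff: "clifford_system m P"
    and mult: "int m \<le> int l - int m - 1"
  shows
    "(\<forall>A \<in> clifford_sphere m P. \<forall>y \<in> E_plus A \<inter> sphere 0 1.
        y \<in> M_minus m P \<and>
        is_direct_sum (E_plus A) (span {y})
          (span (\<Union>N \<in> normal_space_at (sphere 0 1) (M_minus m P) y - {0}.
                   shape_kernel (sphere 0 1) (M_minus m P) y N)))
     \<and>
     (\<forall>m' (Q :: nat \<Rightarrow> real^'n^'n). clifford_system m' Q \<longrightarrow>
        E_plus ` clifford_sphere m' Q = E_plus ` clifford_sphere m P \<longrightarrow>
        clifford_sphere m' Q = clifford_sphere m P)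
     \<and>
     (\<forall>m' (Q :: nat \<Rightarrow> real^'n^'n). clifford_system m' Q \<longrightarrow>
        int m' \<le> int l - int m' - 1 \<longrightarrow>
        isoparametric_family m' Q = isoparametric_family m P \<longrightarrow>
        clifford_sphere m' Q = clifford_sphere m P)
     \<and>
     (\<forall>m' (Q :: nat \<Rightarrow> real^'n^'n). clifford_system m' Q \<longrightarrow>
        int m' \<le> int l - int m' - 1 \<longrightarrow>
        congruent_families (isoparametric_family m P) (isoparametric_family m' Q) \<longrightarrow>
        m' = m \<and> geometrically_equivalent m P Q)"
proof (intro conjI ballI allI impI)
  interpret clifford m P by unfold_locales (rule cliff)
  fix A y assume "A \<in> clifford_sphere m P" "y \<in> E_plus A \<inter> sphere 0 1"
  then have Ay: "A \<in> clifford_sphere m P" "y \<in> E_plus A" "norm y = 1" by auto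
  then show "y \<in> M_minus m P" by (auto simp: M_minus_iff_E_plus)
  \<comment> \<open>The condition m <= l - m - 1 says 2m + 1 <= l; this is its double.\<close>
  have "4 * m + 2 \<le> CARD('n)" using dim mult by linarith
  then show "is_direct_sum (E_plus A) (span {y})
          (span (\<Union>N \<in> normal_space_at (sphere 0 1) (M_minus m P) y - {0}.
                   shape_kernel (sphere 0 1) (M_minus m P) y N))"
    by (rule direct_sum_E_plus[OF Ay])
next
  fix m' and Q :: "nat \<Rightarrow> real^'n^'n"
  assume "clifford_system m' Q" "E_plus ` clifford_sphere m' Q = E_plus ` clifford_sphere m P"
  then show "clifford_sphere m' Q = clifford_sphere m P"
    by (rule clifford_sphere_eq_of_E_plus_eq[OF cliff])
next
  fix m' and Q :: "nat \<Rightarrow> real^'n^'n"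
  assume Q: "clifford_system m' Q" and mult': "int m' \<le> int l - int m' - 1"
  have l: "2 * m + 1 \<le> l" "2 * m' + 1 \<le> l" using mult mult' by linarith+
  show "clifford_sphere m' Q = clifford_sphere m P"
    if "isoparametric_family m' Q = isoparametric_family m P"
    using clifford_sphere_eq_of_family_eq[OF cliff Q dim l that] .
  assume "congruent_families (isoparametric_family m P) (isoparametric_family m' Q)"
  from congruent_families_imp_equivalent[OF cliff Q dim l this]
  show "m' = m" "geometrically_equivalent m P Q" by simp_all
qed

end
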